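(* Let $n\ge2$ be an integer and let $T$ be an arbitrary subset of $\{1,2,\ldots,n-1\}$. Assume that property $\mathrm{P}(n,S)$ (defined in the context) holds for every nonempty subset $S$ of $T$. Let $f\in C^n(0,\infty)$ be real-valued. Then the inequality $$f(a_1)+f(a_2)+\ldots+f(a_n)\le f(b_1)+f(b_2)+\ldots+f(b_n)$$ holds for all $a,b\in\Delta_n$ satisfying $$E_k(a)\le E_k(b)\ \text{ for }k\in T\qquad\text{and}\qquad E_k(a)=E_k(b)\ \text{ for all }k\in\{0,1,\ldots,n-1\}\text{ with }k=0\text{ or }k\notin T$$ if and only if $$(-1)^{n+k}\,(x^kf'(x))^{(n-1)}\le0\quad\text{for all }x>0\text{ and all }k\in T,$$ where $(\cdot)^{(n-1)}$ denotes the $(n-1)$-st derivative with respect to $x$.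
   Context: For $n\ge2$ and $k\in\{0,1,\ldots,n-1\}$, $E_k(y_1,\ldots,y_n)=\sum_{1\le i_1<\ldots<i_{n-k}\le n} y_{i_1}y_{i_2}\cdots y_{i_{n-k}}$ is the elementary symmetric polynomial of degree $n-k$ (so $E_0=y_1\cdots y_n$ and $E_{n-1}=y_1+\ldots+y_n$). Here $\Delta_n=\{y=(y_1,\ldots,y_n)\in(0,\infty)^n : y_1\le y_2\le\ldots\le y_n\}$. Property $\mathrm{P}(n,S)$, for an integer $n\ge2$ and a nonempty subset $S\subseteq\{1,2,\ldots,n-1\}$, is the following statement. For every $a\in\Delta_n$ for which there exist real numbers $A_k>0$ ($k\in S$) such that all the roots of the polynomial $$q(x)=(x+a_1)(x+a_2)\cdots(x+a_n)+\sum_{k\in S}A_kx^k$$ are real, there exist $\varepsilon>0$ and nondecreasing mappings $B_k\colon[0,\varepsilon]\to\mathbb{R}$ ($k\in S$), continuous on $[0,\varepsilon]$ and differentiable on $(0,\varepsilon)$, with $B_k(0)=0$, such that $\sum_{k\in S}B_k(t)$ is (strictly) increasing on $[0,\varepsilon]$ and for all sufficiently small $t>0$ the polynomial $$(x+a_1)(x+a_2)\cdots(x+a_n)+\sum_{k\in S}B_k(t)x^k$$ has $n$ distinct real roots. *)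

theory Defs
  imports "HOL-Analysis.Analysis" "HOL-Computational_Algebra.Computational_Algebra"
begin

text \<open>
  An $n$-tuple $(y_1,\ldots,y_n)$ of reals is a function \<open>y :: nat \<Rightarrow> real\<close> of which only the
  values on \<open>{1..n}\<close> matter.
\<close>

definition Delta :: "nat \<Rightarrow> (nat \<Rightarrow> real) set" where
  "Delta n = {y. (\<forall>i\<in>{1..n}. 0 < y i) \<and> mono_on {1..n} y}"

text \<open>The index follows the power of $x$: \<open>E n k\<close> has degree \<open>n - k\<close>.\<close>

definition E :: "nat \<Rightarrow> nat \<Rightarrow> (nat \<Rightarrow> real) \<Rightarrow> real" where
  "E n k y = (\<Sum>I | I \<subseteq> {1..n} \<and> card I = n - k. \<Prod>i\<in>I. y i)"

definition perturbed_poly :: "nat \<Rightarrow> nat set \<Rightarrow> (nat \<Rightarrow> real) \<Rightarrow> (nat \<Rightarrow> real) \<Rightarrow> real poly" where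
  "perturbed_poly n S a A = (\<Prod>i\<in>{1..n}. [:a i, 1:]) + (\<Sum>k\<in>S. monom (A k) k)"

definition all_roots_real :: "real poly \<Rightarrow> bool" where
  "all_roots_real p \<longleftrightarrow> (\<forall>z::complex. poly (map_poly complex_of_real p) z = 0 \<longrightarrow> z \<in> \<real>)"

text \<open>
  Meant for \<open>n \<ge> 2\<close> and nonempty \<open>S \<subseteq> {1..n - 1}\<close>. The values of \<open>B k\<close> outside \<open>{0..\<epsilon>}\<close>, and
  \<open>B k\<close> for \<open>k \<notin> S\<close>, are irrelevant.
\<close>

definition property_P :: "nat \<Rightarrow> nat set \<Rightarrow> bool" where
  "property_P n S \<longleftrightarrow>
     (\<forall>a \<in> Delta n.
        (\<exists>A :: nat \<Rightarrow> real. (\<forall>k\<in>S. 0 < A k) \<and> all_roots_real (perturbed_poly n S a A)) \<longrightarrow>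
        (\<exists>\<epsilon> > 0. \<exists>B :: nat \<Rightarrow> real \<Rightarrow> real.
           (\<forall>k\<in>S. mono_on {0..\<epsilon>} (B k) \<and> continuous_on {0..\<epsilon>} (B k) \<and>
                  B k differentiable_on {0<..<\<epsilon>} \<and> B k 0 = 0) \<and>
           strict_mono_on {0..\<epsilon>} (\<lambda>t. \<Sum>k\<in>S. B k t) \<and>
           (\<forall>\<^sub>F t in at_right 0. card {x. poly (perturbed_poly n S a (\<lambda>k. B k t)) x = 0} = n)))"

text \<open>
  Membership in $C^n(0,\infty)$. The derivatives are taken over the open set \<open>{0<..}\<close>, so the values
  of \<open>f\<close> outside it play no role.
\<close>

definition C_pos :: "nat \<Rightarrow> (real \<Rightarrow> real) \<Rightarrow> bool" where
  "C_pos n f \<longleftrightarrow>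
     (\<forall>j<n. (deriv ^^ j) f differentiable_on {0<..}) \<and> continuous_on {0<..} ((deriv ^^ n) f)"

end

theory Submission
  imports Defs
begin

text \<open>
  Along a curve of tuples \<open>c(t)\<close> whose polynomial is \<open>\<Prod>(x + c\<^sub>i(t)) = \<Prod>(x + a\<^sub>i) + \<Sum>\<^sub>k B\<^sub>k(t) x\<^sup>k\<close>
  with distinct roots, implicit differentiation turns the derivative of \<open>\<Sum>\<^sub>i f (c\<^sub>i(t))\<close> into
  \<open>\<Sum>\<^sub>k B\<^sub>k'(t) (-1)\<^bsup>k+n-1\<^esup>\<close> times the divided difference of \<open>x\<^sup>k f'(x)\<close> at the nodes \<open>c\<^sub>i(t)\<close>,
  that is, times \<open>1/(n-1)!\<close> of its \<open>(n-1)\<close>-st derivative at an intermediate point.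
  If the derivatives have the right sign, the sum therefore grows along the curves supplied by
  property P. The tuples \<open>c\<close> with \<open>E\<^sub>k(a) \<le> E\<^sub>k(c) \<le> E\<^sub>k(b)\<close> for all \<open>k\<close> whose sum is at least that
  of \<open>a\<close> form a compact set, and one maximising \<open>\<Sum>\<^sub>k E\<^sub>k(c)\<close> must equal \<open>b\<close>, since otherwise such a
  curve starting at \<open>c\<close> would lead to a larger value. Conversely, if a derivative has the wrong
  sign at a point, it has the wrong sign nearby; perturbing the coefficient of \<open>x\<^sup>k\<close> of a polynomial
  with simple roots near the reflected point then decreases the sum.
\<close>

section \<open>Elementary symmetric polynomials and roots\<close>

text \<open>Expand the product over the set \<open>I\<close> of factors that contribute their
  constant term: the other \<open>n - card I\<close> factors contribute a power of the variable.
  Indexing \<open>E\<close> by that power makes it the coefficient itself.\<close>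

lemma coeff_prod_linear:
  assumes "k \<le> n"
  shows "coeff (\<Prod>i\<in>{1..n}. [:y i, 1:]) k = E n k y"
proof -
  have "(\<Prod>i\<in>{1..n}. [:y i, 1:]) = (\<Prod>i\<in>{1..n}. [:y i:] + monom 1 1)"
    by (simp add: monom_Suc flip: one_pCons)
  also have "\<dots> = (\<Sum>I\<in>Pow {1..n}. (\<Prod>i\<in>I. [:y i:]) * (\<Prod>i\<in>{1..n} - I. monom 1 1))"
    by (rule prod_add) simp
  also have "\<dots> = (\<Sum>I\<in>Pow {1..n}. monom (\<Prod>i\<in>I. y i) (n - card I))"
  proof (rule sum.cong[OF refl])
    fix I assume I: "I \<in> Pow {1..n}"
    have "(\<Prod>i\<in>I. [:y i:]) = [:\<Prod>i\<in>I. y i:]"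
      by (induction I rule: infinite_finite_induct) (auto simp: mult.commute)
    moreover have "card ({1..n} - I) = n - card I"
      using I by (subst card_Diff_subset) (auto intro: finite_subset[of _ "{1..n}"] simp del: One_nat_def)
    ultimately show "(\<Prod>i\<in>I. [:y i:]) * (\<Prod>i\<in>{1..n} - I. monom 1 1) = monom (\<Prod>i\<in>I. y i) (n - card I)"
      by (simp add: monom_power smult_monom)
  qed
  finally have "coeff (\<Prod>i\<in>{1..n}. [:y i, 1:]) k =
      (\<Sum>I\<in>Pow {1..n}. if n - card I = k then \<Prod>i\<in>I. y i else 0)"
    by (simp add: coeff_sum)
  also have "\<dots> = (\<Sum>I\<in>{I\<in>Pow {1..n}. n - card I = k}. \<Prod>i\<in>I. y i)"
    by (rule sum.inter_filter[symmetric]) simp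
  \<comment> \<open>Subtraction on naturals truncates, so exchanging the two conditions uses both
    \<open>card I \<le> n\<close> and \<open>k \<le> n\<close>.\<close>
  also have "{I\<in>Pow {1..n}. n - card I = k} = {I. I \<subseteq> {1..n} \<and> card I = n - k}"
  proof -
    have "card I \<le> n" if "I \<subseteq> {1..n}" for I
      using card_mono[OF _ that] by simp
    then show ?thesis
      using assms by (auto; metis diff_diff_cancel)
  qed
  finally show ?thesis
    by (simp add: E_def)
qed

lemma degree_prod_linear: "degree (\<Prod>i\<in>{1..n}. [:y i, 1:] :: real poly) = n"
  by (subst degree_prod_eq_sum_degree) auto

lemma prod_linear_eqI:
  assumes "\<And>k. k < n \<Longrightarrow> E n k y = E n k z"
  shows "(\<Prod>i\<in>{1..n}. [:y i, 1:]) = (\<Prod>i\<in>{1..n}. [:z i, 1:])"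
proof (rule poly_eqI)
  fix k
  show "coeff (\<Prod>i\<in>{1..n}. [:y i, 1:]) k = coeff (\<Prod>i\<in>{1..n}. [:z i, 1:]) k"
  proof (cases k n rule: linorder_cases)
    case less
    then show ?thesis using assms by (simp add: coeff_prod_linear del: One_nat_def)
  next
    case equal
    have "E n n y = E n n z"
      unfolding E_def by (rule sum.cong) (auto dest: finite_subset)
    then show ?thesis
      by (simp add: coeff_prod_linear equal del: One_nat_def)
  next
    case greater
    then show ?thesis
      by (simp add: coeff_eq_0 degree_prod_linear del: One_nat_def)
  qed
qed

text \<open>The values \<open>E n k y\<close> fix the polynomial, hence the multiset of its roots
  \<open>- y i\<close>; a monotone tuple is the sorted list of its entries and so is determined by
  that multiset.\<close>

lemma E_inject:
  assumes "mono_on {1..n} y" "mono_on {1..n} z" and "\<And>k. k < n \<Longrightarrow> E n k y = E n k z"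
    and "i \<in> {1..n}"
  shows "y i = z i"
proof -
  have proots: "proots (\<Prod>i\<in>{1..n}. [:w i, 1:] :: real poly) = image_mset (\<lambda>i. - w i) (mset_set {1..n})" for w
    by (subst proots_prod) (auto simp: sum_unfold_sum_mset)
  have "image_mset uminus (image_mset (\<lambda>i. - y i) (mset_set {1..n})) =
        image_mset uminus (image_mset (\<lambda>i. - z i) (mset_set {1..n}))"
    using prod_linear_eqI[OF assms(3)] by (metis proots)
  then have "mset (map y [1..<Suc n]) = mset (map z [1..<Suc n])"
    by (simp add: multiset.map_comp o_def atLeastLessThanSuc_atLeastAtMost del: upt_Suc)
  moreover have "sorted (map w [1..<Suc n])" if "mono_on {1..n} w" for w :: "nat \<Rightarrow> real"
    using that by (auto simp: sorted_iff_nth_mono nth_append intro!: mono_onD[OF that])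
  ultimately have "map y [1..<Suc n] = map z [1..<Suc n]"
    using assms(1,2) by (metis properties_for_sort)
  then show ?thesis
    using assms(4) by (auto simp del: upt_Suc)
qed

section \<open>Compact sets of tuples and continuity of ordered roots\<close>

lemma continuous_on_E: "continuous_on A (E n k)"
  unfolding E_def by (intro continuous_intros continuous_on_subset[OF continuous_on_product_coordinates]) auto

text \<open>Fixing the entries outside \<open>{1..n}\<close> to 0 lets equality and compactness of
  tuples be taken in the full function space with the product topology.\<close>

definition box_fun :: "nat \<Rightarrow> real \<Rightarrow> real \<Rightarrow> (nat \<Rightarrow> real) set" where
  "box_fun n m M = {c. (\<forall>i\<in>{1..n}. c i \<in> {m..M}) \<and> (\<forall>i. i \<notin> {1..n} \<longrightarrow> c i = 0)}"

text \<open>Tychonoff: the set is a product of compact intervals and singletons.\<close>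

lemma compact_box_fun: "compact (box_fun n m M)"
proof -
  have "box_fun n m M = Pi\<^sub>E UNIV (\<lambda>i. if i \<in> {1..n} then {m..M} else {0})"
    by (auto simp: box_fun_def PiE_iff split: if_splits)
  moreover have "compactin (product_topology (\<lambda>i. euclidean) UNIV)
      (Pi\<^sub>E UNIV (\<lambda>i. if i \<in> {1..n} then {m..M} else {0::real}))"
    unfolding compactin_PiE by (auto simp: compactin_euclidean_iff)
  ultimately show ?thesis
    by (simp add: euclidean_product_topology)
qed

lemma closed_mono_on: "closed {c :: nat \<Rightarrow> real. mono_on A c}"
proof -
  have "closed (\<Inter>i\<in>A. \<Inter>j\<in>{j\<in>A. i \<le> j}. {c :: nat \<Rightarrow> real. c i \<le> c j})"
    by (intro closed_INT ballI closed_Collect_le continuous_on_product_coordinates)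
  also have "(\<Inter>i\<in>A. \<Inter>j\<in>{j\<in>A. i \<le> j}. {c :: nat \<Rightarrow> real. c i \<le> c j}) = {c. mono_on A c}"
    by (auto simp: mono_on_def)
  finally show ?thesis .
qed

text \<open>On a compact set of monotone tuples the injective map \<^term>\<open>E n\<close> has a continuous inverse.\<close>

lemma continuous_on_sorted_roots:
  fixes c :: "'a::topological_space \<Rightarrow> nat \<Rightarrow> real"
  assumes c: "\<And>t. t \<in> U \<Longrightarrow> c t \<in> box_fun n m M \<and> mono_on {1..n} (c t)"
    and cont: "\<And>k. k < n \<Longrightarrow> continuous_on U (\<lambda>t. E n k (c t))"
  shows "continuous_on U (\<lambda>t. c t i)"
proof -
  define K where "K = box_fun n m M \<inter> {c. mono_on {1..n} c}"
  \<comment> \<open>All the symmetric polynomials are bundled into one map between function spaces,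
    so that the inverse of a continuous injection on a compact set can be used.\<close>
  define G where "G = (\<lambda>c k. if k < n then E n k c else 0)"
  have "compact K"
    unfolding K_def by (intro compact_Int_closed compact_box_fun closed_mono_on)
  have "inj_on G K"
  proof (rule inj_onI)
    fix y z assume yz: "y \<in> K" "z \<in> K" "G y = G z"
    have "E n k y = E n k z" if "k < n" for k
      using fun_cong[OF yz(3), of k] that by (simp add: G_def)
    then have "y i = z i" if "i \<in> {1..n}" for i
      using E_inject[of n y z i] that yz by (auto simp: K_def)
    then show "y = z"
      using yz by (intro ext) (metis (mono_tags, lifting) IntD1 K_def box_fun_def mem_Collect_eq)
  qed
  have "continuous_on K G"
    unfolding G_def
  proof (rule continuous_on_coordinatewise_then_product)
    show "continuous_on K (\<lambda>x. if k < n then E n k x else 0)" for k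
      by (cases "k < n") (auto intro: continuous_on_E)
  qed
  then have inv: "continuous_on (G ` K) (the_inv_into K G)"
    using \<open>compact K\<close> \<open>inj_on G K\<close> by (intro continuous_on_inv) (auto simp: the_inv_into_f_f)
  have cK: "c t \<in> K" if "t \<in> U" for t
    using c that by (auto simp: K_def)
  have "continuous_on U (\<lambda>t. G (c t))"
    unfolding G_def
  proof (rule continuous_on_coordinatewise_then_product)
    show "continuous_on U (\<lambda>x. if k < n then E n k (c x) else 0)" for k
      by (cases "k < n") (auto intro: cont)
  qed
  then have "continuous_on U (\<lambda>t. the_inv_into K G (G (c t)))"
    using cK by (intro continuous_on_compose2[OF inv]) auto
  then have "continuous_on U c"
    by (rule continuous_on_eq) (use cK \<open>inj_on G K\<close> in \<open>auto simp: the_inv_into_f_f\<close>)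
  then show ?thesis
    by (rule continuous_on_product_then_coordinatewise)
qed

section \<open>Higher derivatives and divided differences\<close>

lemma C_pos_0: "C_pos 0 f \<longleftrightarrow> continuous_on {0<..} f"
  by (simp add: C_pos_def)

lemma C_pos_Suc: "C_pos (Suc n) f \<longleftrightarrow> f differentiable_on {0<..} \<and> C_pos n (deriv f)"
  by (auto simp: C_pos_def All_less_Suc2 funpow_Suc_right simp del: funpow.simps)

text \<open>Agreement on the open half-line is agreement near each of its points, so it passes to
  \<open>deriv\<close> and, by induction, to every higher derivative.\<close>

lemma higher_deriv_cong_pos:
  fixes f g :: "real \<Rightarrow> real"
  assumes "\<And>x. x > 0 \<Longrightarrow> f x = g x" and "x > 0"
  shows "(deriv ^^ n) f x = (deriv ^^ n) g x"
  using assms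
proof (induction n arbitrary: f g)
  case (Suc n)
  have "deriv f y = deriv g y" if "y > 0" for y
  proof (rule deriv_cong_ev)
    show "eventually (\<lambda>x. f x = g x) (nhds y)"
      using eventually_nhds_in_open[of "{0<..}" y] that
      by (auto elim!: eventually_mono intro: Suc.prems(1))
  qed simp
  then show ?case
    using Suc.IH[of "deriv f" "deriv g"] Suc.prems(2)
    by (simp add: funpow_Suc_right del: funpow.simps)
qed auto

lemma C_pos_cong:
  assumes "\<And>x. x > 0 \<Longrightarrow> f x = g x"
  shows "C_pos n f \<longleftrightarrow> C_pos n g"
proof -
  have eq: "(deriv ^^ j) f x = (deriv ^^ j) g x" if "x \<in> {0<..}" for j x
    using higher_deriv_cong_pos[of f g] assms that by auto
  have differentiable_cong: "q differentiable_on {0<..}"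
    if "p differentiable_on {0<..}" "\<And>x. x \<in> {0<..} \<Longrightarrow> p x = q x" for p q :: "real \<Rightarrow> real"
    using that unfolding differentiable_on_def
    by (intro ballI differentiable_transform_within[of p _ _ 1 q]) auto
  have "(deriv ^^ j) f differentiable_on {0<..} \<longleftrightarrow> (deriv ^^ j) g differentiable_on {0<..}" for j
    by (rule iffI; erule differentiable_cong) (simp_all add: eq)
  moreover have "continuous_on {0<..} ((deriv ^^ n) f) \<longleftrightarrow> continuous_on {0<..} ((deriv ^^ n) g)"
    by (rule continuous_on_cong) (auto intro: eq)
  ultimately show ?thesis
    by (simp add: C_pos_def)
qed

lemma C_pos_SucD:
  assumes "C_pos (Suc n) f"
  shows "x > 0 \<Longrightarrow> (f has_real_derivative deriv f x) (at x)" and "C_pos n (deriv f)"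
  using assms
  by (auto simp: C_pos_Suc DERIV_deriv_iff_real_differentiable differentiable_on_eq_differentiable_at)

text \<open>Allows the derivative to be given by a formula valid on the half-line; the closure
  properties of \<open>C_pos\<close> below are inductions through this rule.\<close>

lemma C_pos_SucI:
  assumes "\<And>x. x > 0 \<Longrightarrow> (f has_real_derivative f' x) (at x)" and "C_pos n f'"
  shows "C_pos (Suc n) f"
  unfolding C_pos_Suc
proof
  show "f differentiable_on {0<..}"
    using assms(1) by (auto simp: differentiable_on_eq_differentiable_at real_differentiable_def)
  show "C_pos n (deriv f)"
    using assms by (subst C_pos_cong[of _ f']) (auto intro: DERIV_imp_deriv)
qed

lemma C_pos_Suc_imp_C_pos: "C_pos (Suc n) f \<Longrightarrow> C_pos n f"
proof (induction n arbitrary: f)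
  case 0
  then show ?case
    by (auto simp: C_pos_0 C_pos_Suc intro: differentiable_imp_continuous_on)
next
  case (Suc n)
  then show ?case
    by (metis C_pos_Suc)
qed

lemma C_pos_add: "C_pos n f \<Longrightarrow> C_pos n g \<Longrightarrow> C_pos n (\<lambda>x. f x + g x)"
proof (induction n arbitrary: f g)
  case (Suc n)
  then show ?case
    by (intro C_pos_SucI[of _ "\<lambda>x. deriv f x + deriv g x"] DERIV_add Suc.IH) (auto intro: C_pos_SucD)
qed (auto simp: C_pos_0 intro: continuous_intros)

lemma C_pos_mult: "C_pos n f \<Longrightarrow> C_pos n g \<Longrightarrow> C_pos n (\<lambda>x. f x * g x)"
proof (induction n arbitrary: f g)
  case (Suc n)
  then show ?case
    by (intro C_pos_SucI[of _ "\<lambda>x. deriv f x * g x + deriv g x * f x"] DERIV_mult C_pos_add Suc.IH)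
       (auto intro: C_pos_SucD C_pos_Suc_imp_C_pos)
qed (auto simp: C_pos_0 intro: continuous_intros)

lemma C_pos_poly: "C_pos n (poly p)"
proof (induction n arbitrary: p)
  case (Suc n)
  show ?case
    by (rule C_pos_SucI[of _ "poly (pderiv p)"]) (auto intro: Suc.IH)
qed (auto simp: C_pos_0 intro: continuous_intros)

lemma C_pos_diff: "C_pos n f \<Longrightarrow> C_pos n g \<Longrightarrow> C_pos n (\<lambda>x. f x - g x)"
  using C_pos_add[of n f "\<lambda>x. (-1) * g x"] C_pos_mult[OF C_pos_poly[of n "[:-1:]"], of g] by simp

lemma higher_deriv_diff_pos:
  assumes "C_pos n f" "C_pos n g" and "x > 0"
  shows "(deriv ^^ n) (\<lambda>x. f x - g x) x = (deriv ^^ n) f x - (deriv ^^ n) g x"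
  using assms(1,2)
proof (induction n arbitrary: f g)
  case (Suc n)
  have "(deriv ^^ n) (deriv (\<lambda>x. f x - g x)) x = (deriv ^^ n) (\<lambda>x. deriv f x - deriv g x) x"
    using Suc.prems \<open>x > 0\<close>
    by (intro higher_deriv_cong_pos DERIV_imp_deriv DERIV_diff) (auto intro: C_pos_SucD)
  then show ?case
    using Suc.IH[of "deriv f" "deriv g"] C_pos_SucD(2)[OF Suc.prems(1)] C_pos_SucD(2)[OF Suc.prems(2)]
    by (simp add: funpow_Suc_right del: funpow.simps)
qed auto

section \<open>Rolle's theorem and the mean value theorem for divided differences\<close>

lemma higher_deriv_poly: "(deriv ^^ n) (poly p) = poly ((pderiv ^^ n) p)"
  for p :: "real poly"
proof (induction n)
  case (Suc n)
  then show ?case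
    by (auto intro!: DERIV_imp_deriv)
qed auto

text \<open>Induction adds points from the right, and Rolle is applied between the old maximum and
  the new point. The clause \<open>z < Max Z\<close> strengthens the induction: the new zero lies
  beyond \<open>Max A\<close>, hence differs from all earlier ones.\<close>

lemma Rolle_finite_set:
  fixes h :: "real \<Rightarrow> real"
  assumes "finite Z" "Z \<noteq> {}" "Z \<subseteq> {lo..hi}" and "\<And>z. z \<in> Z \<Longrightarrow> h z = 0"
    and "\<And>x. x \<in> {lo..hi} \<Longrightarrow> (h has_real_derivative h' x) (at x)"
  shows "\<exists>Z'. finite Z' \<and> Z' \<subseteq> {lo..hi} \<and> Suc (card Z') = card Z \<and>
    (\<forall>z\<in>Z'. h' z = 0 \<and> z < Max Z)"
  using assms(1-4)
proof (induction Z rule: finite_linorder_max_induct)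
  case (insert b A)
  show ?case
  proof (cases "A = {}")
    case True
    then show ?thesis by (intro exI[of _ "{}"]) auto
  next
    case False
    then obtain Z' where Z': "finite Z'" "Z' \<subseteq> {lo..hi}" "Suc (card Z') = card A"
      "\<And>z. z \<in> Z' \<Longrightarrow> h' z = 0" "\<And>z. z \<in> Z' \<Longrightarrow> z < Max A"
      using insert.IH insert.prems by (metis insert_subset insertI2)
    have MaxA: "Max A \<in> A" and less: "Max A < b"
      using insert False by auto
    have sub: "{Max A..b} \<subseteq> {lo..hi}"
      using insert.prems MaxA by auto
    have "\<exists>z>Max A. z < b \<and> (h has_real_derivative 0) (at z)"
    proof (rule Rolle[OF less])
      show "h (Max A) = h b"
        using insert.prems MaxA by simp
      show "continuous_on {Max A..b} h"
        using sub assms(5) by (intro continuous_at_imp_continuous_on) (blast intro: DERIV_isCont)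
      show "h differentiable (at x)" if "Max A < x" "x < b" for x
        using sub assms(5)[of x] that by (auto simp: real_differentiable_def)
    qed
    then obtain z where z: "Max A < z" "z < b" "(h has_real_derivative 0) (at z)"
      by blast
    have zin: "z \<in> {lo..hi}"
      using sub z by auto
    have "h' z = 0"
      using DERIV_unique[OF z(3) assms(5)[OF zin]] by simp
    moreover have "z \<notin> Z'"
      using Z'(5) z(1) by force
    moreover have "Max (insert b A) = b"
      using insert.hyps by (intro Max_eqI) (auto intro: less_imp_le)
    moreover have "b \<notin> A"
      using insert by auto
    moreover have "x < b" if "x \<in> Z'" for x
      using Z'(5)[OF that] less by simp
    ultimately show ?thesis
      using Z' z zin insert.hyps by (intro exI[of _ "insert z Z'"]) auto
  qed
qed auto

text \<open>Each differentiation costs one zero, so \<open>Suc n\<close> zeros leave one after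
  \<open>n\<close> steps. The bound \<open>0 < lo\<close> keeps all of them where
  \<open>C_pos\<close> gives information.\<close>

lemma higher_Rolle:
  assumes "C_pos n h" "finite Z" "card Z = Suc n" "Z \<subseteq> {lo..hi}" "0 < lo" "\<And>z. z \<in> Z \<Longrightarrow> h z = 0"
  shows "\<exists>\<xi>\<in>{lo..hi}. (deriv ^^ n) h \<xi> = 0"
  using assms
proof (induction n arbitrary: h Z)
  case 0
  then show ?case
    by (auto simp: card_Suc_eq)
next
  case (Suc n)
  have "(h has_real_derivative deriv h x) (at x)" if "x \<in> {lo..hi}" for x
    using Suc.prems(1,5) that by (intro C_pos_SucD) auto
  then obtain Z' where "finite Z'" "Z' \<subseteq> {lo..hi}" "card Z' = Suc n" "\<And>z. z \<in> Z' \<Longrightarrow> deriv h z = 0"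
    using Rolle_finite_set[of Z lo hi h "deriv h"] Suc.prems by fastforce
  then show ?case
    using Suc.IH[of "deriv h" Z'] C_pos_SucD(2)[OF Suc.prems(1)] \<open>0 < lo\<close>
    by (simp add: funpow_Suc_right del: funpow.simps)
qed

text \<open>The left-hand side is the leading coefficient of the Lagrange interpolation polynomial of
  \<open>g\<close> at the nodes \<open>c i\<close>.\<close>

lemma divided_difference_mean_value:
  fixes c :: "'a \<Rightarrow> real"
  assumes I: "finite I" "inj_on c I" "card I = Suc m" and c: "c ` I \<subseteq> {lo..hi}" "0 < lo"
    and g: "C_pos m g"
  shows "\<exists>\<xi>\<in>{lo..hi}. (\<Sum>i\<in>I. g (c i) / (\<Prod>j\<in>I - {i}. c i - c j)) = (deriv ^^ m) g \<xi> / fact m"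
proof -
  define w where "w = (\<lambda>i. g (c i) / (\<Prod>j\<in>I - {i}. c i - c j))"
  define l where "l = (\<lambda>i. \<Prod>j\<in>I - {i}. [:- c j, 1:])"
  define L where "L = (\<Sum>i\<in>I. smult (w i) (l i))"
  have deg_l: "degree (l i) = m" and coeff_l: "coeff (l i) m = 1" if "i \<in> I" for i
  proof -
    show "degree (l i) = m"
      unfolding l_def using I that by (subst degree_prod_eq_sum_degree) auto
    moreover have "lead_coeff (l i) = 1"
      unfolding l_def by (simp add: lead_coeff_prod)
    ultimately show "coeff (l i) m = 1"
      by simp
  qed
  \<comment> \<open>\<open>L\<close> has degree at most \<open>m\<close>, so its \<open>m\<close>-th
    derivative is constant, namely \<open>fact m\<close> times the coefficient that is
    sought.\<close>
  have "coeff L k = 0" if "k > m" for k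
    unfolding L_def using deg_l that by (simp add: coeff_sum coeff_eq_0)
  then have higher_L: "(pderiv ^^ m) L = [:fact m * coeff L m:]"
    by (intro poly_eqI) (auto simp: coeff_higher_pderiv coeff_pCons pochhammer_fact split: nat.splits)
  have coeff_L: "coeff L m = (\<Sum>i\<in>I. w i)"
    unfolding L_def by (simp add: coeff_sum coeff_l)
  have interpol: "poly L (c i) = g (c i)" if i: "i \<in> I" for i
  proof -
    have "poly (l j) (c i) = 0" if "j \<in> I" "j \<noteq> i" for j
      unfolding l_def poly_prod using I i that by (intro prod_zero) auto
    then have "poly L (c i) = w i * poly (l i) (c i)"
      unfolding L_def using I i by (simp add: poly_sum sum.remove[of I i])
    moreover have "poly (l i) (c i) = (\<Prod>j\<in>I - {i}. c i - c j)"
      by (simp add: l_def poly_prod)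
    moreover have "(\<Prod>j\<in>I - {i}. c i - c j) \<noteq> 0"
      using I i by (auto simp: inj_on_eq_iff)
    ultimately show ?thesis
      by (simp add: w_def)
  qed
  \<comment> \<open>The interpolation error vanishes at the \<open>Suc m\<close> distinct
    nodes.\<close>
  have "\<exists>\<xi>\<in>{lo..hi}. (deriv ^^ m) (\<lambda>x. g x - poly L x) \<xi> = 0"
  proof (rule higher_Rolle[where Z = "c ` I"])
    show "C_pos m (\<lambda>x. g x - poly L x)"
      by (intro C_pos_diff g C_pos_poly)
  qed (use I c interpol in \<open>auto simp: card_image\<close>)
  then obtain \<xi> where "\<xi> \<in> {lo..hi}" "(deriv ^^ m) (\<lambda>x. g x - poly L x) \<xi> = 0"
    by blast
  moreover from this have "(deriv ^^ m) g \<xi> = fact m * (\<Sum>i\<in>I. w i)"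
    using higher_deriv_diff_pos[OF g C_pos_poly, of \<xi> L] c
    by (simp add: higher_deriv_poly higher_L coeff_L)
  ultimately show ?thesis
    by (intro bexI[of _ \<xi>]) (auto simp: w_def)
qed

section \<open>Curves of roots\<close>

lemma E_cong:
  assumes "\<And>i. i \<in> {1..n} \<Longrightarrow> y i = z i"
  shows "E n k y = E n k z"
  unfolding E_def using assms by (intro sum.cong prod.cong) auto

lemma E_0: "E n 0 y = (\<Prod>i\<in>{1..n}. y i)"
proof -
  have "{I. I \<subseteq> {1..n} \<and> card I = n - 0} = {{1..n}}"
    by (auto dest: card_subset_eq[OF finite_atLeastAtMost])
  then show ?thesis
    by (simp only: E_def) simp
qed

lemma E_pred:
  assumes "n \<ge> 1"
  shows "E n (n - 1) y = (\<Sum>i\<in>{1..n}. y i)"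
proof -
  have "{I. I \<subseteq> {1..n} \<and> card I = n - (n - 1)} = (\<lambda>i. {i}) ` {1..n}"
    using assms by (auto simp: card_1_singleton_iff)
  then have "E n (n - 1) y = (\<Sum>I\<in>(\<lambda>i. {i}) ` {1..n}. \<Prod>i\<in>I. y i)"
    by (simp only: E_def)
  then show ?thesis
    by (subst (asm) sum.reindex) auto
qed

lemma poly_prod_linear: "poly (\<Prod>i\<in>I. [:y i, 1:]) x = (\<Prod>i\<in>I. x + y i)"
  by (simp add: poly_prod add.commute)

lemma poly_perturbed_poly:
  "poly (perturbed_poly n S a A) x = (\<Prod>i\<in>{1..n}. x + a i) + (\<Sum>k\<in>S. A k * x ^ k)"
  by (simp add: perturbed_poly_def poly_sum poly_monom poly_prod_linear del: One_nat_def)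

lemma coeff_perturbed_poly:
  assumes "finite S" "k \<le> n"
  shows "coeff (perturbed_poly n S a A) k = E n k a + (if k \<in> S then A k else 0)"
  using assms
  by (simp add: perturbed_poly_def coeff_sum coeff_prod_linear del: One_nat_def)

lemma degree_perturbed_poly_le:
  assumes "S \<subseteq> {..<n}"
  shows "degree (perturbed_poly n S a A) \<le> n"
  unfolding perturbed_poly_def
proof (rule degree_add_le)
  show "degree (\<Sum>k\<in>S. monom (A k) k) \<le> n"
    using assms
    by (intro degree_sum_le finite_subset[OF assms])
       (auto intro: order_trans[OF degree_monom_le] less_imp_le)
qed (simp add: degree_prod_linear del: One_nat_def)

lemma E_self: "E n n y = 1"
proof -
  have "{I. I \<subseteq> {1..n} \<and> card I = n - n} = {{}}"
    by (auto dest: finite_subset)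
  then show ?thesis
    by (simp only: E_def) simp
qed

text \<open>The roots are negative because nonnegative coefficients \<open>A k\<close> keep the polynomial positive on
  \<open>{0..}\<close>.\<close>

lemma ex_Delta_roots:
  assumes a: "a \<in> Delta n" and S: "S \<subseteq> {..<n}" and A: "\<And>k. k \<in> S \<Longrightarrow> 0 \<le> A k"
    and card: "card {x. poly (perturbed_poly n S a A) x = 0} = n"
  obtains c where "c \<in> Delta n" "inj_on c {1..n}" "\<And>i. i \<notin> {1..n} \<Longrightarrow> c i = 0"
    "perturbed_poly n S a A = (\<Prod>i\<in>{1..n}. [:c i, 1:])"
proof -
  define p where "p = perturbed_poly n S a A"
  define L where "L = sorted_list_of_set (uminus ` {x. poly p x = 0})"
  \<comment> \<open>List positions start at 0 and tuple indices at 1, hence the shift.\<close>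
  define c where "c = (\<lambda>i. if i \<in> {1..n} then L ! (i - 1) else 0)"
  have "finite S"
    using S finite_subset by blast
  have coeff_n: "coeff p n = 1"
    using S \<open>finite S\<close> by (auto simp: p_def coeff_perturbed_poly E_self)
  then have "p \<noteq> 0"
    by auto
  then have fin: "finite {x. poly p x = 0}"
    by (rule poly_roots_finite)
  have neg: "x < 0" if "poly p x = 0" for x
  proof (rule ccontr)
    assume "\<not> x < 0"
    then have "(\<Prod>i\<in>{1..n}. x + a i) > 0" "(\<Sum>k\<in>S. A k * x ^ k) \<ge> 0"
      using a A by (auto simp: Delta_def intro!: prod_pos sum_nonneg mult_nonneg_nonneg add_nonneg_pos)
    then show False
      using that by (simp add: p_def poly_perturbed_poly del: One_nat_def)
  qed
  have len: "length L = n"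
    using card fin by (simp add: L_def card_image p_def)
  have setL: "set L = uminus ` {x. poly p x = 0}"
    using fin by (simp add: L_def)
  have "sorted L" "distinct L"
    by (simp_all add: L_def)
  have in_L: "c i \<in> set L" if "i \<in> {1..n}" for i
    using that len by (auto simp: c_def)
  have root: "poly p (- c i) = 0" if "i \<in> {1..n}" for i
    using in_L[OF that] setL by auto
  have inj: "inj_on c {1..n}"
    using \<open>distinct L\<close> len by (auto simp: inj_on_def c_def nth_eq_iff_index_eq)
  have c_outside: "c i = 0" if "i \<notin> {1..n}" for i
    using that by (auto simp: c_def)
  have "p = (\<Prod>i\<in>{1..n}. [:c i, 1:])"
  \<comment> \<open>Both polynomials have degree at most \<open>n\<close> and the same coefficient 1
    at \<open>n\<close>, so agreement at the \<open>n\<close> distinct points \<open>- c i\<close>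
    suffices.\<close>
  proof (rule poly_eqI_degree_lead_coeff[where A = "(\<lambda>i. - c i) ` {1..n}"])
    show "coeff p n = coeff (\<Prod>i\<in>{1..n}. [:c i, 1:]) n"
      by (simp add: coeff_n coeff_prod_linear E_self del: One_nat_def)
    have "inj_on (\<lambda>i. - c i) {1..n}"
      by (rule inj_onI) (rule inj_onD[OF inj], auto)
    then show "n \<le> card ((\<lambda>i. - c i) ` {1..n})"
      by (simp add: card_image)
    show "degree p \<le> n"
      unfolding p_def by (rule degree_perturbed_poly_le[OF S])
    fix z assume "z \<in> (\<lambda>i. - c i) ` {1..n}"
    then obtain i where "i \<in> {1..n}" "z = - c i"
      by blast
    moreover from this have "(\<Prod>j\<in>{1..n}. - c i + c j) = 0"
      by (intro prod_zero) auto
    ultimately show "poly p z = poly (\<Prod>i\<in>{1..n}. [:c i, 1:]) z"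
      using root by (simp add: poly_prod_linear del: One_nat_def)
  qed (simp add: degree_prod_linear del: One_nat_def)
  moreover have "c \<in> Delta n"
    unfolding Delta_def
  proof (intro CollectI conjI ballI)
    show "0 < c i" if "i \<in> {1..n}" for i
      using neg[OF root[OF that]] by simp
    show "mono_on {1..n} c"
      using \<open>sorted L\<close> len by (auto simp: mono_on_def c_def intro: sorted_nth_mono)
  qed
  ultimately show ?thesis
    using that[OF _ inj c_outside] by (simp add: p_def)
qed

section \<open>Root curves and their derivatives\<close>

lemma Delta_le_sum:
  assumes "c \<in> Delta n" "i \<in> {1..n}"
  shows "c i \<le> (\<Sum>j\<in>{1..n}. c j)"
  using assms by (intro member_le_sum) (auto simp: Delta_def intro: less_imp_le)

text \<open>The tuple is chosen separately for each \<open>t\<close>; continuity follows because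
  ordered roots depend continuously on the coefficients. At \<open>t = 0\<close> the entries of
  \<open>a\<close> may coincide, so that case takes \<open>a\<close> itself, and distinctness is
  claimed only for \<open>t > 0\<close>.\<close>

lemma ex_root_curve:
  fixes B :: "nat \<Rightarrow> real \<Rightarrow> real"
  assumes n: "n \<ge> 1" and a: "a \<in> Delta n" and S: "S \<subseteq> {..<n}" and "0 \<le> e"
    and mono: "\<And>k. k \<in> S \<Longrightarrow> mono_on {0..e} (B k)"
    and cont: "\<And>k. k \<in> S \<Longrightarrow> continuous_on {0..e} (B k)"
    and B0: "\<And>k. k \<in> S \<Longrightarrow> B k 0 = 0"
    and card: "\<And>t. t \<in> {0<..e} \<Longrightarrow> card {x. poly (perturbed_poly n S a (\<lambda>k. B k t)) x = 0} = n"
  obtains c where "\<And>t. t \<in> {0..e} \<Longrightarrow> c t \<in> Delta n"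
    "\<And>t. t \<in> {0<..e} \<Longrightarrow> inj_on (c t) {1..n}"
    "\<And>t i. t \<in> {0..e} \<Longrightarrow> i \<notin> {1..n} \<Longrightarrow> c t i = 0"
    "\<And>t. t \<in> {0..e} \<Longrightarrow> perturbed_poly n S a (\<lambda>k. B k t) = (\<Prod>i\<in>{1..n}. [:c t i, 1:])"
    "\<And>i. i \<in> {1..n} \<Longrightarrow> c 0 i = a i"
    "\<And>i. continuous_on {0..e} (\<lambda>t. c t i)"
proof -
  have "finite S"
    using S finite_subset by blast
  have B_nonneg: "0 \<le> B k t" if "k \<in> S" "t \<in> {0..e}" for k t
  proof -
    have "B k 0 \<le> B k t"
      by (rule mono_onD[OF mono[OF that(1)]]) (use that(2) in auto)
    then show ?thesis
      using B0[OF that(1)] by simp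
  qed
  have "\<exists>y. y \<in> Delta n \<and> (t > 0 \<longrightarrow> inj_on y {1..n}) \<and> (\<forall>i. i \<notin> {1..n} \<longrightarrow> y i = 0) \<and>
      perturbed_poly n S a (\<lambda>k. B k t) = (\<Prod>i\<in>{1..n}. [:y i, 1:])" if t: "t \<in> {0..e}" for t
  proof (cases "t = 0")
    case True
    define y where "y = (\<lambda>i. if i \<in> {1..n} then a i else 0)"
    have "y \<in> Delta n"
      using a by (auto simp: Delta_def mono_on_def y_def)
    moreover have "perturbed_poly n S a (\<lambda>k. B k t) = (\<Prod>i\<in>{1..n}. [:y i, 1:])"
      using True B0 by (simp add: perturbed_poly_def y_def)
    ultimately show ?thesis
      using True by (auto simp: y_def)
  next
    case False
    then have "t \<in> {0<..e}"
      using t by auto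
    obtain y where "y \<in> Delta n" "inj_on y {1..n}" "\<And>i. i \<notin> {1..n} \<Longrightarrow> y i = 0"
      "perturbed_poly n S a (\<lambda>k. B k t) = (\<Prod>i\<in>{1..n}. [:y i, 1:])"
      by (rule ex_Delta_roots[OF a S B_nonneg[OF _ t] card[OF \<open>t \<in> {0<..e}\<close>]]) (assumption, rule that)
    then show ?thesis
      by (intro exI[of _ y]) simp
  qed
  then have "\<forall>t\<in>{0..e}. \<exists>y. y \<in> Delta n \<and> (t > 0 \<longrightarrow> inj_on y {1..n}) \<and>
      (\<forall>i. i \<notin> {1..n} \<longrightarrow> y i = 0) \<and>
      perturbed_poly n S a (\<lambda>k. B k t) = (\<Prod>i\<in>{1..n}. [:y i, 1:])"
    by blast
  from bchoice[OF this] obtain c where c: "\<And>t. t \<in> {0..e} \<Longrightarrow> c t \<in> Delta n"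
    "\<And>t. t \<in> {0..e} \<Longrightarrow> t > 0 \<Longrightarrow> inj_on (c t) {1..n}"
    "\<And>t i. t \<in> {0..e} \<Longrightarrow> i \<notin> {1..n} \<Longrightarrow> c t i = 0"
    "\<And>t. t \<in> {0..e} \<Longrightarrow> perturbed_poly n S a (\<lambda>k. B k t) = (\<Prod>i\<in>{1..n}. [:c t i, 1:])"
    by blast
  \<comment> \<open>Comparing coefficients: along the curve each \<open>E n k\<close> moves exactly
    by \<open>B k t\<close>, or stays fixed if \<open>k\<close> is not in \<open>S\<close>.\<close>
  have E_c: "E n k (c t) = E n k a + (if k \<in> S then B k t else 0)" if "t \<in> {0..e}" "k < n" for k t
    using coeff_perturbed_poly[of S k n a "\<lambda>k. B k t"] coeff_prod_linear[of k n "c t"] c(4)[OF that(1)]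
      that(2) \<open>finite S\<close> by simp
  have "c 0 i = a i" if "i \<in> {1..n}" for i
  proof (rule E_inject[OF _ _ _ that])
    show "mono_on {1..n} (c 0)" "mono_on {1..n} a"
      using a c(1)[of 0] \<open>0 \<le> e\<close> by (auto simp: Delta_def)
    show "E n k (c 0) = E n k a" if "k < n" for k
      using E_c[of 0 k] that \<open>0 \<le> e\<close> B0 by auto
  qed
  moreover have "continuous_on {0..e} (\<lambda>t. c t i)" for i
  proof (rule continuous_on_sorted_roots)
    \<comment> \<open>The sum of the entries is \<open>E n (n - 1)\<close>, which is nondecreasing
      in \<open>t\<close>, so its value at \<open>e\<close> bounds every entry.\<close>
    define M where "M = E n (n - 1) a + (if n - 1 \<in> S then B (n - 1) e else 0)"
    fix t assume t: "t \<in> {0..e}"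
    have "c t i \<le> M" if "i \<in> {1..n}" for i
    proof -
      have "c t i \<le> E n (n - 1) (c t)"
        using Delta_le_sum[OF c(1)[OF t] that] E_pred[OF n] by simp
      also have "\<dots> = E n (n - 1) a + (if n - 1 \<in> S then B (n - 1) t else 0)"
        using E_c[OF t, of "n - 1"] n by simp
      also have "\<dots> \<le> M"
        using t mono_onD[OF mono, of "n - 1" t e] by (auto simp: M_def)
      finally show ?thesis .
    qed
    then show "c t \<in> box_fun n 0 M \<and> mono_on {1..n} (c t)"
      using c(1)[OF t] c(3)[OF t] by (auto simp: box_fun_def Delta_def intro: less_imp_le)
  next
    fix k assume k: "k < n"
    have "continuous_on {0..e} (\<lambda>t. E n k a + (if k \<in> S then B k t else 0))"
      by (cases "k \<in> S") (auto intro!: continuous_intros cont)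
    then show "continuous_on {0..e} (\<lambda>t. E n k (c t))"
      by (rule continuous_on_eq) (simp add: E_c k)
  qed
  ultimately show ?thesis
    using that[of c] c by auto
qed

text \<open>Evaluate the polynomials for \<open>t\<close> and \<open>t0\<close> at
  \<open>- c t i\<close> and subtract. This gives an exact factorisation of
  \<open>c t i - c t0 i\<close>; dividing by \<open>t - t0\<close> and passing to the limit replaces
  the implicit function theorem.\<close>

lemma root_has_derivative:
  fixes c :: "real \<Rightarrow> nat \<Rightarrow> real" and B :: "nat \<Rightarrow> real \<Rightarrow> real"
  assumes U: "open U" "t0 \<in> U"
    and roots: "\<And>t. t \<in> U \<Longrightarrow> perturbed_poly n S a (\<lambda>k. B k t) = (\<Prod>i\<in>{1..n}. [:c t i, 1:])"
    and cont: "isCont (\<lambda>t. c t i) t0" and inj: "inj_on (c t0) {1..n}"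
    and B: "\<And>k. k \<in> S \<Longrightarrow> (B k has_real_derivative D k) (at t0)"
    and i: "i \<in> {1..n}"
  shows "((\<lambda>t. c t i) has_real_derivative
    (\<Sum>k\<in>S. D k * (- c t0 i) ^ k) / (\<Prod>j\<in>{1..n} - {i}. c t0 j - c t0 i)) (at t0)"
proof -
  \<comment> \<open>The other roots are frozen at \<open>t0\<close> and only root \<open>i\<close>
    moves, so continuity of this one root is enough.\<close>
  define Q where "Q = (\<lambda>t. \<Prod>j\<in>{1..n} - {i}. c t0 j - c t i)"
  have lim_c: "((\<lambda>t. c t i) \<longlongrightarrow> c t0 i) (at t0)"
    using cont by (simp add: isCont_def)
  have lim_Q: "(Q \<longlongrightarrow> Q t0) (at t0)"
    unfolding Q_def by (intro tendsto_intros lim_c)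
  have "Q t0 \<noteq> 0"
    using inj i by (auto simp: Q_def inj_on_eq_iff)
  have eq: "(c t i - c t0 i) * Q t = (\<Sum>k\<in>S. (B k t - B k t0) * (- c t i) ^ k)" if t: "t \<in> U" for t
  proof -
    have val: "(\<Prod>j\<in>{1..n}. x + a j) + (\<Sum>k\<in>S. B k s * x ^ k) = (\<Prod>j\<in>{1..n}. x + c s j)"
      if "s \<in> U" for s x
      using arg_cong[OF roots[OF that], of "\<lambda>p. poly p x"]
      by (simp add: poly_perturbed_poly poly_prod_linear del: One_nat_def)
    have "(\<Prod>j\<in>{1..n}. - c t i + c t j) = 0"
      using i by (intro prod_zero) auto
    moreover have "(\<Prod>j\<in>{1..n}. - c t i + c t0 j) = (c t0 i - c t i) * Q t"
      using i by (simp add: Q_def prod.remove[of "{1..n}" i] del: One_nat_def)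
    moreover have "(\<Sum>k\<in>S. (B k t - B k t0) * (- c t i) ^ k) =
        (\<Sum>k\<in>S. B k t * (- c t i) ^ k) - (\<Sum>k\<in>S. B k t0 * (- c t i) ^ k)"
      by (simp add: left_diff_distrib sum_subtractf)
    moreover have "(c t i - c t0 i) * Q t = - ((c t0 i - c t i) * Q t)"
      by (simp add: algebra_simps)
    ultimately show ?thesis
      using val[OF t, of "- c t i"] val[OF U(2), of "- c t i"] by linarith
  qed
  have "((\<lambda>t. (\<Sum>k\<in>S. (B k t - B k t0) / (t - t0) * (- c t i) ^ k) / Q t)
      \<longlongrightarrow> (\<Sum>k\<in>S. D k * (- c t0 i) ^ k) / Q t0) (at t0)"
    using B by (intro tendsto_intros lim_c lim_Q \<open>Q t0 \<noteq> 0\<close>) (auto simp: has_field_derivative_iff)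
  moreover have "\<forall>\<^sub>F t in at t0. (\<Sum>k\<in>S. (B k t - B k t0) / (t - t0) * (- c t i) ^ k) / Q t
      = (c t i - c t0 i) / (t - t0)"
    using tendsto_imp_eventually_ne[OF lim_Q \<open>Q t0 \<noteq> 0\<close>] eventually_at_in_open'[OF U]
  proof eventually_elim
    case (elim t)
    then show ?case
      using eq[of t] by (simp add: divide_simps flip: sum_divide_distrib)
  qed
  ultimately show ?thesis
    unfolding has_field_derivative_iff Q_def by (rule Lim_transform_eventually)
qed

text \<open>The mean value theorem in \<open>t\<close> gives \<open>\<tau>\<close>; then for each
  \<open>k\<close> the sum over the roots is a divided difference, which gives its own
  \<open>\<xi> k\<close> between the extreme roots. Differentiability is used only inside the
  interval, so multiple roots at the start do no harm.\<close>

lemma root_curve_sum_mean_value: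
  fixes c :: "real \<Rightarrow> nat \<Rightarrow> real" and B D :: "nat \<Rightarrow> real \<Rightarrow> real"
  assumes n: "n \<ge> 1" and f: "C_pos n f" and "0 < e"
    and c: "\<And>t. t \<in> {0..e} \<Longrightarrow> c t \<in> Delta n"
    and inj: "\<And>t. t \<in> {0<..<e} \<Longrightarrow> inj_on (c t) {1..n}"
    and roots: "\<And>t. t \<in> {0<..<e} \<Longrightarrow> perturbed_poly n S a (\<lambda>k. B k t) = (\<Prod>i\<in>{1..n}. [:c t i, 1:])"
    and cont: "\<And>i. i \<in> {1..n} \<Longrightarrow> continuous_on {0..e} (\<lambda>t. c t i)"
    and B: "\<And>k t. k \<in> S \<Longrightarrow> t \<in> {0<..<e} \<Longrightarrow> (B k has_real_derivative D k t) (at t)"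
  shows "\<exists>\<tau>\<in>{0<..<e}. \<exists>\<xi>. (\<forall>k. \<xi> k \<in> {c \<tau> 1..c \<tau> n}) \<and>
    (\<Sum>i\<in>{1..n}. f (c e i)) - (\<Sum>i\<in>{1..n}. f (c 0 i)) =
    e * (\<Sum>k\<in>S. D k \<tau> * ((-1) ^ (k + (n - 1)) *
      (deriv ^^ (n - 1)) (\<lambda>u. u ^ k * deriv f u) (\<xi> k) / fact (n - 1)))"
proof -
  define m where "m = n - 1"
  have n_eq: "n = Suc m"
    using n by (simp add: m_def)
  define F where "F = (\<lambda>t. \<Sum>i\<in>{1..n}. f (c t i))"
  define Q where "Q = (\<lambda>t i. \<Prod>j\<in>{1..n} - {i}. c t j - c t i)"
  define F' where "F' = (\<lambda>t. \<Sum>i\<in>{1..n}. deriv f (c t i) * ((\<Sum>k\<in>S. D k t * (- c t i) ^ k) / Q t i))"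
  have c_pos: "0 < c t i" if "t \<in> {0..e}" "i \<in> {1..n}" for t i
    using c[OF that(1)] that(2) by (auto simp: Delta_def)
  have df: "(f has_real_derivative deriv f x) (at x)" if "x > 0" for x
    using f that unfolding n_eq by (rule C_pos_SucD)
  have F': "(F has_real_derivative F' t) (at t)" if t: "t \<in> {0<..<e}" for t
    unfolding F_def F'_def
  proof (intro DERIV_sum DERIV_chain2[of f])
    fix i assume i: "i \<in> {1..n}"
    have "isCont (\<lambda>t. c t i) t"
      using cont[OF i] t by (simp add: continuous_on_interior)
    then show "((\<lambda>t. c t i) has_real_derivative (\<Sum>k\<in>S. D k t * (- c t i) ^ k) / Q t i) (at t)"
      unfolding Q_def
      by (intro root_has_derivative[where U = "{0<..<e}" and S = S and a = a and B = B] roots inj B i t) auto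
    show "(f has_real_derivative deriv f (c t i)) (at (c t i))"
      using c_pos[OF _ i, of t] t by (intro df) auto
  qed
  have "continuous_on {0..e} F"
    unfolding F_def
  proof (rule continuous_on_sum)
    fix i assume i: "i \<in> {1..n}"
    have "continuous_on {0<..} f"
      using df by (intro continuous_at_imp_continuous_on) (auto intro: DERIV_isCont)
    then show "continuous_on {0..e} (\<lambda>t. f (c t i))"
      by (rule continuous_on_compose2[OF _ cont[OF i]]) (use c_pos i in auto)
  qed
  moreover have "F differentiable (at t)" if "0 < t" "t < e" for t
    using F'[of t] that by (auto simp: real_differentiable_def)
  ultimately obtain l \<tau> where \<tau>: "0 < \<tau>" "\<tau> < e" "(F has_real_derivative l) (at \<tau>)" "F e - F 0 = (e - 0) * l"
    using MVT[OF \<open>0 < e\<close>, of F] by blast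
  then have "l = F' \<tau>"
    using DERIV_unique F'[of \<tau>] by auto
  have mem: "\<tau> \<in> {0<..<e}" "\<tau> \<in> {0..e}"
    using \<tau> by auto
  have "\<exists>\<xi>\<in>{c \<tau> 1..c \<tau> n}. (\<Sum>i\<in>{1..n}. (c \<tau> i ^ k * deriv f (c \<tau> i)) / (\<Prod>j\<in>{1..n} - {i}. c \<tau> i - c \<tau> j)) =
      (deriv ^^ m) (\<lambda>u. u ^ k * deriv f u) \<xi> / fact m" for k
  proof (rule divided_difference_mean_value)
    show "c \<tau> ` {1..n} \<subseteq> {c \<tau> 1..c \<tau> n}"
      using c[OF mem(2)] by (auto simp: Delta_def mono_on_def)
    show "0 < c \<tau> 1"
      using n by (intro c_pos mem) auto
    show "C_pos m (\<lambda>u. u ^ k * deriv f u)"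
      using C_pos_mult[OF C_pos_poly[of m "monom 1 k"] C_pos_SucD(2)[OF f[unfolded n_eq]]]
      by (simp add: poly_monom)
  qed (use inj[OF mem(1)] in \<open>auto simp: n_eq\<close>)
  then have "\<forall>k. \<exists>\<xi>. \<xi> \<in> {c \<tau> 1..c \<tau> n} \<and>
      (\<Sum>i\<in>{1..n}. (c \<tau> i ^ k * deriv f (c \<tau> i)) / (\<Prod>j\<in>{1..n} - {i}. c \<tau> i - c \<tau> j)) =
      (deriv ^^ m) (\<lambda>u. u ^ k * deriv f u) \<xi> / fact m"
    by blast
  from choice[OF this] obtain \<xi> where \<xi>: "\<And>k. \<xi> k \<in> {c \<tau> 1..c \<tau> n}"
    "\<And>k. (\<Sum>i\<in>{1..n}. (c \<tau> i ^ k * deriv f (c \<tau> i)) / (\<Prod>j\<in>{1..n} - {i}. c \<tau> i - c \<tau> j)) =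
      (deriv ^^ m) (\<lambda>u. u ^ k * deriv f u) (\<xi> k) / fact m"
    by blast
  \<comment> \<open>The \<open>m\<close> differences in \<open>Q\<close> are reversed relative to
    those of the divided difference.\<close>
  have Q_flip: "Q t i = (-1) ^ m * (\<Prod>j\<in>{1..n} - {i}. c t i - c t j)" if "i \<in> {1..n}" for t i
  proof -
    have "Q t i = (\<Prod>j\<in>{1..n} - {i}. (-1) * (c t i - c t j))"
      by (simp add: Q_def)
    also have "\<dots> = (-1) ^ m * (\<Prod>j\<in>{1..n} - {i}. c t i - c t j)"
      using that by (subst prod.distrib) (simp add: n_eq)
    finally show ?thesis .
  qed
  have "F' \<tau> = (\<Sum>i\<in>{1..n}. \<Sum>k\<in>S. D k \<tau> * (-1) ^ (k + m) *
      ((c \<tau> i ^ k * deriv f (c \<tau> i)) / (\<Prod>j\<in>{1..n} - {i}. c \<tau> i - c \<tau> j)))"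
    unfolding F'_def
  proof (rule sum.cong[OF refl])
    fix i assume i: "i \<in> {1..n}"
    show "deriv f (c \<tau> i) * ((\<Sum>k\<in>S. D k \<tau> * (- c \<tau> i) ^ k) / Q \<tau> i) =
      (\<Sum>k\<in>S. D k \<tau> * (-1) ^ (k + m) *
        ((c \<tau> i ^ k * deriv f (c \<tau> i)) / (\<Prod>j\<in>{1..n} - {i}. c \<tau> i - c \<tau> j)))"
      unfolding Q_flip[OF i] sum_divide_distrib sum_distrib_left
    proof (rule sum.cong[OF refl])
      fix k
      have "(- c \<tau> i) ^ k = (-1) ^ k * c \<tau> i ^ k"
        by (rule power_minus)
      then show "deriv f (c \<tau> i) * (D k \<tau> * (- c \<tau> i) ^ k / ((-1) ^ m * (\<Prod>j\<in>{1..n} - {i}. c \<tau> i - c \<tau> j))) =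
        D k \<tau> * (-1) ^ (k + m) * ((c \<tau> i ^ k * deriv f (c \<tau> i)) / (\<Prod>j\<in>{1..n} - {i}. c \<tau> i - c \<tau> j))"
        by (simp add: power_add minus_one_power_iff)
    qed
  qed
  \<comment> \<open>For fixed \<open>k\<close> the inner sum is now the divided difference of
    \<open>u ^ k * deriv f u\<close>.\<close>
  also have "\<dots> = (\<Sum>k\<in>S. \<Sum>i\<in>{1..n}. D k \<tau> * (-1) ^ (k + m) *
      ((c \<tau> i ^ k * deriv f (c \<tau> i)) / (\<Prod>j\<in>{1..n} - {i}. c \<tau> i - c \<tau> j)))"
    by (rule sum.swap)
  also have "\<dots> = (\<Sum>k\<in>S. D k \<tau> * (-1) ^ (k + m) * ((deriv ^^ m) (\<lambda>u. u ^ k * deriv f u) (\<xi> k) / fact m))"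
    by (simp only: \<xi>(2) flip: sum_distrib_left)
  finally have "F e - F 0 = e * (\<Sum>k\<in>S. D k \<tau> * (-1) ^ (k + m) *
      ((deriv ^^ m) (\<lambda>u. u ^ k * deriv f u) (\<xi> k) / fact m))"
    using \<tau>(4) \<open>l = F' \<tau>\<close> by simp
  then show ?thesis
    using mem(1) \<xi>(1) unfolding F_def m_def[symmetric]
    by (intro bexI[of _ \<tau>] exI[of _ \<xi>]) (auto simp: mult.assoc)
qed

section \<open>Sufficiency of the sign condition\<close>

lemma all_roots_real_prod_linear: "all_roots_real (\<Prod>i\<in>I. [:y i, 1:])"
proof (cases "finite I")
  case True
  have mult: "map_poly complex_of_real (p * q) = map_poly complex_of_real p * map_poly complex_of_real q" for p q
    by (rule poly_eqI) (simp add: coeff_map_poly coeff_mult)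
  have "map_poly complex_of_real (\<Prod>i\<in>I. [:y i, 1:]) = (\<Prod>i\<in>I. [:complex_of_real (y i), 1:])"
    using True by induction (simp_all add: mult map_poly_pCons del: mult_pCons_left)
  then show ?thesis
    using True by (auto simp: all_roots_real_def poly_prod add_eq_0_iff Reals_minus_iff)
next
  case False
  then show ?thesis
    by (simp add: all_roots_real_def)
qed

text \<open>\<open>E n (n - 1)\<close> bounds the entries from above, and the lower bound on their
  product \<open>E n 0\<close> keeps them away from 0. The tuples therefore lie in a box on which
  \<open>f\<close> is continuous.\<close>

lemma compact_E_fiber:
  fixes f :: "real \<Rightarrow> real"
  assumes n: "n \<ge> 1" and a: "a \<in> Delta n" and f: "continuous_on {0<..} f"
  shows "compact {c \<in> Delta n. (\<forall>i. i \<notin> {1..n} \<longrightarrow> c i = 0) \<and>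
    (\<forall>k<n. E n k a \<le> E n k c \<and> E n k c \<le> E n k b) \<and> s \<le> (\<Sum>i\<in>{1..n}. f (c i))}"
    (is "compact ?K")
proof -
  define M where "M = E n (n - 1) b"
  \<comment> \<open>One entry times at most \<open>M ^ (n - 1)\<close> must reach
    \<open>E n 0 a\<close>.\<close>
  define l where "l = E n 0 a / M ^ (n - 1)"
  define K where "K = box_fun n l M \<inter> {c. mono_on {1..n} c} \<inter>
    (\<Inter>k\<in>{..<n}. {c. E n k a \<le> E n k c} \<inter> {c. E n k c \<le> E n k b})"
  show ?thesis
  proof (cases "M > 0")
    case False
    have "?K = {}"
    proof (rule ccontr)
      assume "?K \<noteq> {}"
      then obtain c where c: "c \<in> Delta n" "E n (n - 1) c \<le> M"
        using n by (force simp: M_def)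
      have "0 < c 1" "c 1 \<le> E n (n - 1) c"
        using c(1) n Delta_le_sum[OF c(1), of 1] E_pred[OF n, of c] by (auto simp: Delta_def)
      then show False
        using c(2) False by simp
    qed
    then show ?thesis
      by (simp only: compact_empty)
  next
    case M: True
    have "0 < E n 0 a"
      using a by (auto simp: E_0 Delta_def intro!: prod_pos)
    then have l: "0 < l"
      using M by (simp add: l_def)
    have box: "c \<in> box_fun n l M"
      if c: "c \<in> Delta n" "\<And>i. i \<notin> {1..n} \<Longrightarrow> c i = 0" "E n 0 a \<le> E n 0 c" "E n (n - 1) c \<le> M" for c
    proof -
      have pos: "0 < c i" and le: "c i \<le> M" if "i \<in> {1..n}" for i
        using that c(1) Delta_le_sum[OF c(1) that] c(4) E_pred[OF n, of c] by (auto simp: Delta_def)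
      have "l \<le> c i" if i: "i \<in> {1..n}" for i
      proof -
        have "E n 0 a \<le> (\<Prod>j\<in>{1..n}. c j)"
          using c(3) by (simp add: E_0)
        also have "\<dots> = c i * (\<Prod>j\<in>{1..n} - {i}. c j)"
          using i by (intro prod.remove) auto
        also have "(\<Prod>j\<in>{1..n} - {i}. c j) \<le> (\<Prod>j\<in>{1..n} - {i}. M)"
          using pos le by (intro prod_mono) (auto intro: less_imp_le)
        also have "(\<Prod>j\<in>{1..n} - {i}. M) = M ^ (n - 1)"
          using i by simp
        finally have "E n 0 a \<le> c i * M ^ (n - 1)"
          using pos[OF i] by simp
        then show ?thesis
          using M by (simp add: l_def divide_le_eq)
      qed
      then show ?thesis
        using le c(2) by (auto simp: box_fun_def)
    qed
    have "compact K"
      unfolding K_def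
      by (intro compact_Int_closed compact_box_fun closed_mono_on closed_INT closed_Int ballI
          closed_Collect_le continuous_on_E continuous_on_const)
    moreover have "continuous_on K (\<lambda>c. \<Sum>i\<in>{1..n}. f (c i))"
    proof (rule continuous_on_sum, rule continuous_on_compose2[OF f])
      show "continuous_on K (\<lambda>c. c i)" for i
        by (rule continuous_on_subset[OF continuous_on_product_coordinates]) simp
      show "(\<lambda>c. c i) ` K \<subseteq> {0<..}" if "i \<in> {1..n}" for i
        using that l by (auto simp: K_def box_fun_def intro: less_le_trans)
    qed
    then have "closedin (top_of_set K) (K \<inter> (\<lambda>c. \<Sum>i\<in>{1..n}. f (c i)) -` {s..})"
      by (rule continuous_closedin_preimage) simp
    ultimately have "compact (K \<inter> (\<lambda>c. \<Sum>i\<in>{1..n}. f (c i)) -` {s..})"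
      by (rule closedin_compact)
    \<comment> \<open>Positivity is not a closed condition; the bound by \<open>l\<close> replaces
      it.\<close>
    moreover have "K \<inter> (\<lambda>c. \<Sum>i\<in>{1..n}. f (c i)) -` {s..} = ?K"
    proof (intro subset_antisym subsetI)
      fix c assume "c \<in> K \<inter> (\<lambda>c. \<Sum>i\<in>{1..n}. f (c i)) -` {s..}"
      then show "c \<in> ?K"
        using l by (force simp: K_def box_fun_def Delta_def intro: less_le_trans)
    next
      fix c assume "c \<in> ?K"
      then show "c \<in> K \<inter> (\<lambda>c. \<Sum>i\<in>{1..n}. f (c i)) -` {s..}"
        using box[of c] n by (auto simp: K_def Delta_def M_def)
    qed
    ultimately show ?thesis
      by simp
  qed
qed

text \<open>Property P applies at \<open>c\<close> because \<open>b\<close> itself provides the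
  admissible perturbation: adding the positive gaps \<open>E n k b - E n k c\<close> yields the
  polynomial of \<open>b\<close>, whose roots are real. Stopping the resulting curve early enough
  keeps every \<open>E n k\<close> below its value at \<open>b\<close>.\<close>

lemma ex_increase:
  assumes n: "n \<ge> 2" and S: "S \<subseteq> {1..n - 1}" "S \<noteq> {}" and P: "property_P n S"
    and f: "C_pos n f"
    and sign: "\<And>x k. x > 0 \<Longrightarrow> k \<in> S \<Longrightarrow>
      (-1) ^ (n + k) * (deriv ^^ (n - 1)) (\<lambda>u. u ^ k * deriv f u) x \<le> 0"
    and c: "c \<in> Delta n" and b: "b \<in> Delta n"
    and less: "\<And>k. k \<in> S \<Longrightarrow> E n k c < E n k b"
    and eq: "\<And>k. k < n \<Longrightarrow> k \<notin> S \<Longrightarrow> E n k c = E n k b"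
  obtains d where "d \<in> Delta n" "\<And>i. i \<notin> {1..n} \<Longrightarrow> d i = 0"
    "\<And>k. k < n \<Longrightarrow> E n k c \<le> E n k d \<and> E n k d \<le> E n k b"
    "(\<Sum>k<n. E n k c) < (\<Sum>k<n. E n k d)"
    "(\<Sum>i\<in>{1..n}. f (c i)) \<le> (\<Sum>i\<in>{1..n}. f (d i))"
proof -
  have Sn: "S \<subseteq> {..<n}"
    using S n by auto
  then have "finite S"
    using finite_subset by blast
  have "perturbed_poly n S c (\<lambda>k. E n k b - E n k c) = (\<Prod>i\<in>{1..n}. [:b i, 1:])"
  proof (rule poly_eqI)
    fix k
    show "coeff (perturbed_poly n S c (\<lambda>k. E n k b - E n k c)) k = coeff (\<Prod>i\<in>{1..n}. [:b i, 1:]) k"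
    proof (cases k n rule: linorder_cases)
      case greater
      then have "coeff (perturbed_poly n S c (\<lambda>k. E n k b - E n k c)) k = 0"
        by (intro coeff_eq_0 le_less_trans[OF degree_perturbed_poly_le[OF Sn]])
      moreover have "coeff (\<Prod>i\<in>{1..n}. [:b i, 1:]) k = 0"
        using greater by (intro coeff_eq_0) (simp only: degree_prod_linear)
      ultimately show ?thesis by simp
    next
      case equal
      then show ?thesis
        using Sn \<open>finite S\<close>
        by (auto simp: coeff_perturbed_poly coeff_prod_linear E_self simp del: One_nat_def)
    next
      case less
      then show ?thesis
        using \<open>finite S\<close> eq[of k]
        by (auto simp: coeff_perturbed_poly coeff_prod_linear simp del: One_nat_def)
    qed
  qed
  then have "\<exists>A. (\<forall>k\<in>S. 0 < A k) \<and> all_roots_real (perturbed_poly n S c A)"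
    using less by (intro exI[of _ "\<lambda>k. E n k b - E n k c"]) (simp add: all_roots_real_prod_linear del: One_nat_def)
  then obtain \<epsilon> :: real and B :: "nat \<Rightarrow> real \<Rightarrow> real" where "\<epsilon> > 0" and
    B: "\<And>k. k \<in> S \<Longrightarrow> mono_on {0..\<epsilon>} (B k)" "\<And>k. k \<in> S \<Longrightarrow> continuous_on {0..\<epsilon>} (B k)"
      "\<And>k. k \<in> S \<Longrightarrow> B k differentiable_on {0<..<\<epsilon>}" "\<And>k. k \<in> S \<Longrightarrow> B k 0 = 0" and
    strict: "strict_mono_on {0..\<epsilon>} (\<lambda>t. \<Sum>k\<in>S. B k t)" and
    ev_card: "\<forall>\<^sub>F t in at_right 0. card {x. poly (perturbed_poly n S c (\<lambda>k. B k t)) x = 0} = n"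
    using P c unfolding property_P_def by blast
  have "\<forall>\<^sub>F t in at_right 0. \<forall>k\<in>S. B k t < E n k b - E n k c"
  proof (intro eventually_ball_finite \<open>finite S\<close> ballI)
    fix k assume k: "k \<in> S"
    have "(B k \<longlongrightarrow> B k 0) (at 0 within {0..\<epsilon>})"
      using B(2)[OF k] \<open>\<epsilon> > 0\<close> by (auto simp: continuous_on_def)
    then have "(B k \<longlongrightarrow> 0) (at_right 0)"
      using B(4)[OF k] \<open>\<epsilon> > 0\<close> by (simp add: at_within_Icc_at_right)
    then show "\<forall>\<^sub>F t in at_right 0. B k t < E n k b - E n k c"
      using less[OF k] by (intro order_tendstoD(2)[where a = "E n k b - E n k c"]) auto
  qed
  moreover have "\<forall>\<^sub>F t in at_right 0. t < \<epsilon>"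
    using \<open>\<epsilon> > 0\<close> by (auto simp: eventually_at_right_field)
  ultimately have "\<forall>\<^sub>F t in at_right 0. (\<forall>k\<in>S. B k t < E n k b - E n k c) \<and> t < \<epsilon> \<and>
      card {x. poly (perturbed_poly n S c (\<lambda>k. B k t)) x = 0} = n"
    using ev_card by eventually_elim blast
  then obtain \<delta> where "\<delta> > 0" and \<delta>: "\<And>t. 0 < t \<Longrightarrow> t < \<delta> \<Longrightarrow> (\<forall>k\<in>S. B k t < E n k b - E n k c) \<and> t < \<epsilon> \<and>
      card {x. poly (perturbed_poly n S c (\<lambda>k. B k t)) x = 0} = n"
    by (auto simp: eventually_at_right_field)
  \<comment> \<open>Halving puts the closed right end \<open>e\<close> strictly inside the range
    where the eventual properties hold.\<close>
  define e where "e = \<delta> / 2"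
  have e: "0 < e" "e < \<delta>" "e < \<epsilon>"
    using \<delta>[of e] \<open>\<delta> > 0\<close> by (auto simp: e_def)
  have sub: "{0..e} \<subseteq> {0..\<epsilon>}"
    using e by auto
  have "n \<ge> 1" "0 \<le> e"
    using n e by auto
  have mono_e: "mono_on {0..e} (B k)" if "k \<in> S" for k
    using B(1)[OF that] sub by (rule mono_on_subset)
  have cont_e: "continuous_on {0..e} (B k)" if "k \<in> S" for k
    using B(2)[OF that] sub by (rule continuous_on_subset)
  have card_e: "card {x. poly (perturbed_poly n S c (\<lambda>k. B k t)) x = 0} = n" if "t \<in> {0<..e}" for t
    using \<delta>[of t] that e by auto
  obtain y where y: "\<And>t. t \<in> {0..e} \<Longrightarrow> y t \<in> Delta n"
    "\<And>t. t \<in> {0<..e} \<Longrightarrow> inj_on (y t) {1..n}"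
    "\<And>t i. t \<in> {0..e} \<Longrightarrow> i \<notin> {1..n} \<Longrightarrow> y t i = 0"
    "\<And>t. t \<in> {0..e} \<Longrightarrow> perturbed_poly n S c (\<lambda>k. B k t) = (\<Prod>i\<in>{1..n}. [:y t i, 1:])"
    "\<And>i. i \<in> {1..n} \<Longrightarrow> y 0 i = c i"
    "\<And>i. continuous_on {0..e} (\<lambda>t. y t i)"
    by (rule ex_root_curve[of n c S e B, OF \<open>n \<ge> 1\<close> c Sn \<open>0 \<le> e\<close>])
       (erule mono_e cont_e B(4) card_e | rule that; assumption)+
  have E_y: "E n k (y e) = E n k c + (if k \<in> S then B k e else 0)" if "k < n" for k
    using coeff_perturbed_poly[of S k n c "\<lambda>k. B k e"] coeff_prod_linear[of k n "y e"] y(4)[of e] e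
      that \<open>finite S\<close> by simp
  have B_nonneg: "0 \<le> B k e" if "k \<in> S" for k
    using mono_onD[OF mono_e[OF that], of 0 e] B(4)[OF that] e by simp
  have deriv_B: "(B k has_real_derivative deriv (B k) t) (at t)" if "k \<in> S" "t \<in> {0<..<e}" for k t
    using B(3)[OF that(1)] that(2) e
    by (auto simp: differentiable_on_eq_differentiable_at DERIV_deriv_iff_real_differentiable)
  have "\<exists>\<tau>\<in>{0<..<e}. \<exists>\<xi>. (\<forall>k. \<xi> k \<in> {y \<tau> 1..y \<tau> n}) \<and>
    (\<Sum>i\<in>{1..n}. f (y e i)) - (\<Sum>i\<in>{1..n}. f (y 0 i)) =
    e * (\<Sum>k\<in>S. deriv (B k) \<tau> * ((-1) ^ (k + (n - 1)) *
      (deriv ^^ (n - 1)) (\<lambda>u. u ^ k * deriv f u) (\<xi> k) / fact (n - 1)))"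
  proof (rule root_curve_sum_mean_value[OF \<open>n \<ge> 1\<close> f \<open>0 < e\<close> y(1) _ _ y(6) deriv_B])
    show "inj_on (y t) {1..n}" if "t \<in> {0<..<e}" for t
      using that by (intro y(2)) simp
    show "perturbed_poly n S c (\<lambda>k. B k t) = (\<Prod>i\<in>{1..n}. [:y t i, 1:])" if "t \<in> {0<..<e}" for t
      using that by (intro y(4)) simp
  qed
  then obtain \<tau> \<xi> where \<tau>: "\<tau> \<in> {0<..<e}" "\<And>k. \<xi> k \<in> {y \<tau> 1..y \<tau> n}"
    "(\<Sum>i\<in>{1..n}. f (y e i)) - (\<Sum>i\<in>{1..n}. f (y 0 i)) =
     e * (\<Sum>k\<in>S. deriv (B k) \<tau> * ((-1) ^ (k + (n - 1)) *
      (deriv ^^ (n - 1)) (\<lambda>u. u ^ k * deriv f u) (\<xi> k) / fact (n - 1)))"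
    by blast
  have "0 \<le> deriv (B k) \<tau> * ((-1) ^ (k + (n - 1)) *
      (deriv ^^ (n - 1)) (\<lambda>u. u ^ k * deriv f u) (\<xi> k) / fact (n - 1))" if k: "k \<in> S" for k
  proof (rule mult_nonneg_nonneg[OF _ divide_nonneg_nonneg])
    show "0 \<le> deriv (B k) \<tau>"
      using \<tau>(1) by (intro mono_on_imp_deriv_nonneg[OF mono_e[OF k] deriv_B[OF k \<tau>(1)]]) simp
    have "0 < y \<tau> 1"
      using y(1)[of \<tau>] \<tau>(1) \<open>n \<ge> 1\<close> by (auto simp: Delta_def)
    then have "0 < \<xi> k"
      using \<tau>(2)[of k] by simp
    \<comment> \<open>The exponents differ by one, so the assumed sign \<open>\<le> 0\<close>
      becomes the nonnegativity wanted here.\<close>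
    moreover have "(-1::real) ^ (n + k) = - ((-1) ^ (k + (n - 1)))"
      using \<open>n \<ge> 1\<close> by (cases n) (simp_all add: add.commute)
    ultimately show "0 \<le> (-1) ^ (k + (n - 1)) * (deriv ^^ (n - 1)) (\<lambda>u. u ^ k * deriv f u) (\<xi> k)"
      using sign[OF _ k, of "\<xi> k"] by simp
  qed simp
  then have "0 \<le> (\<Sum>i\<in>{1..n}. f (y e i)) - (\<Sum>i\<in>{1..n}. f (y 0 i))"
    unfolding \<tau>(3) using \<open>0 \<le> e\<close> by (intro mult_nonneg_nonneg[OF _ sum_nonneg])
  moreover have "(\<Sum>i\<in>{1..n}. f (y 0 i)) = (\<Sum>i\<in>{1..n}. f (c i))"
    using y(5) by simp
  moreover have "E n k c \<le> E n k (y e) \<and> E n k (y e) \<le> E n k b" if "k < n" for k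
    using E_y[OF that] B_nonneg \<delta>[of e] e eq[OF that] by (cases "k \<in> S") (auto simp: less_imp_le field_simps)
  moreover have "(\<Sum>k<n. E n k c) < (\<Sum>k<n. E n k (y e))"
  proof -
    \<comment> \<open>Individual \<open>B k\<close> may be constant; strict growth comes from their
      sum.\<close>
    have "0 = (\<Sum>k\<in>S. B k 0)"
      using B(4) by simp
    also have "\<dots> < (\<Sum>k\<in>S. B k e)"
      using strict_mono_onD[OF strict, of 0 e] e by simp
    also have "\<dots> = (\<Sum>k<n. if k \<in> S then B k e else 0)"
      using Sn by (simp add: sum.If_cases inf_absorb2)
    finally show ?thesis
      by (simp add: E_y sum.distrib)
  qed
  ultimately show ?thesis
    using that[of "y e"] y(1,3)[of e] e by simp
qed

text \<open>The set \<open>S\<close> of indices at which the maximiser falls short of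
  \<open>b\<close> is not known in advance, which is why property P is assumed for every nonempty
  subset of \<open>T\<close>.\<close>

lemma sum_le_sum_if_E_le:
  assumes n: "n \<ge> 2" and T: "T \<subseteq> {1..n - 1}"
    and P: "\<And>S. S \<subseteq> T \<Longrightarrow> S \<noteq> {} \<Longrightarrow> property_P n S" and f: "C_pos n f"
    and sign: "\<And>x k. x > 0 \<Longrightarrow> k \<in> T \<Longrightarrow>
      (-1) ^ (n + k) * (deriv ^^ (n - 1)) (\<lambda>u. u ^ k * deriv f u) x \<le> 0"
    and a: "a \<in> Delta n" and b: "b \<in> Delta n"
    and le: "\<And>k. k \<in> T \<Longrightarrow> E n k a \<le> E n k b"
    and eq: "\<And>k. k < n \<Longrightarrow> k \<notin> T \<Longrightarrow> E n k a = E n k b"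
  shows "(\<Sum>i\<in>{1..n}. f (a i)) \<le> (\<Sum>i\<in>{1..n}. f (b i))"
proof -
  define K where "K = {c \<in> Delta n. (\<forall>i. i \<notin> {1..n} \<longrightarrow> c i = 0) \<and>
    (\<forall>k<n. E n k a \<le> E n k c \<and> E n k c \<le> E n k b) \<and> (\<Sum>i\<in>{1..n}. f (a i)) \<le> (\<Sum>i\<in>{1..n}. f (c i))}"
  have "f differentiable_on {0<..}"
    using f n by (cases n) (auto simp: C_pos_Suc)
  then have "compact K"
    unfolding K_def using n a by (intro compact_E_fiber differentiable_imp_continuous_on) auto
  moreover have "K \<noteq> {}"
  proof -
    define a' where "a' = (\<lambda>i. if i \<in> {1..n} then a i else 0)"
    have "a' \<in> Delta n"
      using a by (auto simp: Delta_def mono_on_def a'_def)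
    moreover have "E n k a' = E n k a" for k
      by (rule E_cong) (simp add: a'_def)
    moreover have "(\<Sum>i\<in>{1..n}. f (a' i)) = (\<Sum>i\<in>{1..n}. f (a i))"
      by (simp add: a'_def)
    moreover have "E n k a \<le> E n k b" if "k < n" for k
      using le eq[OF that] by (cases "k \<in> T") auto
    moreover have "\<forall>i. i \<notin> {1..n} \<longrightarrow> a' i = 0"
      by (simp add: a'_def)
    ultimately have "a' \<in> K"
      unfolding K_def by simp
    then show ?thesis
      by blast
  qed
  moreover have "continuous_on K (\<lambda>c. \<Sum>k<n. E n k c)"
    by (intro continuous_intros continuous_on_E)
  ultimately obtain c where c: "c \<in> K" and max: "\<And>d. d \<in> K \<Longrightarrow> (\<Sum>k<n. E n k d) \<le> (\<Sum>k<n. E n k c)"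
    using continuous_attains_sup[of K "\<lambda>c. \<Sum>k<n. E n k c"] by blast
  have c_D: "c \<in> Delta n" "\<And>k. k < n \<Longrightarrow> E n k a \<le> E n k c" "\<And>k. k < n \<Longrightarrow> E n k c \<le> E n k b"
    "(\<Sum>i\<in>{1..n}. f (a i)) \<le> (\<Sum>i\<in>{1..n}. f (c i))"
    using c by (auto simp: K_def)
  define S where "S = {k\<in>T. E n k c < E n k b}"
  have S_T: "S \<subseteq> T"
    by (auto simp: S_def)
  have eq_c: "E n k c = E n k b" if "k < n" "k \<notin> S" for k
    using c_D(2,3)[OF that(1)] eq[OF that(1)] that(2) by (force simp: S_def)
  have "S = {}"
  proof (rule ccontr)
    assume "S \<noteq> {}"
    obtain d where d: "d \<in> Delta n" "\<And>i. i \<notin> {1..n} \<Longrightarrow> d i = 0"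
      "\<And>k. k < n \<Longrightarrow> E n k c \<le> E n k d \<and> E n k d \<le> E n k b"
      "(\<Sum>k<n. E n k c) < (\<Sum>k<n. E n k d)"
      "(\<Sum>i\<in>{1..n}. f (c i)) \<le> (\<Sum>i\<in>{1..n}. f (d i))"
    proof (rule ex_increase[OF n _ \<open>S \<noteq> {}\<close> _ f _ c_D(1) b])
      show "S \<subseteq> {1..n - 1}"
        using S_T T by blast
      show "property_P n S"
        by (rule P) fact+
      show "(-1) ^ (n + k) * (deriv ^^ (n - 1)) (\<lambda>u. u ^ k * deriv f u) x \<le> 0" if "x > 0" "k \<in> S" for x k
        using sign that S_T by blast
      show "E n k c < E n k b" if "k \<in> S" for k
        using that by (simp add: S_def)
      show "E n k c = E n k b" if "k < n" "k \<notin> S" for k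
        using that by (rule eq_c)
    qed (rule that)
    have "d \<in> K"
      unfolding K_def using d c_D by (auto intro: order_trans)
    then show False
      using max[of d] d(4) by simp
  qed
  have "c i = b i" if "i \<in> {1..n}" for i
  proof (rule E_inject[OF _ _ _ that])
    show "mono_on {1..n} c" "mono_on {1..n} b"
      using c_D(1) b by (auto simp: Delta_def)
    show "E n k c = E n k b" if "k < n" for k
      using eq_c[OF that] \<open>S = {}\<close> by simp
  qed
  then show ?thesis
    using c_D(4) by simp
qed

section \<open>Necessity of the sign condition\<close>

text \<open>Distinct nodes in a small interval to the right of \<open>x0\<close> and the points halfway between them.
  The perturbed polynomial still changes sign between consecutive halfway points, so all its roots
  are real, simple and confined to the reflected interval.\<close>

lemma ex_small_perturbation_roots:
  assumes "0 < x0" "0 < \<delta>" and k: "k < n"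
  obtains a e where "a \<in> Delta n" "0 < e"
    "\<And>t. t \<in> {0<..e} \<Longrightarrow> card {x. poly (perturbed_poly n {k} a (\<lambda>_. t)) x = 0} = n"
    "\<And>t x. t \<in> {0<..e} \<Longrightarrow> poly (perturbed_poly n {k} a (\<lambda>_. t)) x = 0 \<Longrightarrow> - x \<in> {x0<..<x0 + \<delta>}"
proof -
  define s where "s = \<delta> / (real n + 1)"
  \<comment> \<open>With this spacing even the last halfway point, at
    \<open>x0 + s * (n + 1/2)\<close>, stays below \<open>x0 + \<delta>\<close>.\<close>
  have s: "0 < s"
    using assms by (simp add: s_def)
  define a where "a = (\<lambda>i. x0 + s * real i)"
  define M where "M = (\<lambda>i. x0 + s * (real i + 1 / 2))"
  define p where "p = (\<lambda>t. perturbed_poly n {k} a (\<lambda>_. t))"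
  have a: "a \<in> Delta n"
    using s \<open>0 < x0\<close> by (auto simp: Delta_def mono_on_def a_def intro: add_pos_nonneg)
  have M_mono: "M i < M j" if "i < j" for i j
    using that s by (simp add: M_def)
  have M_range: "x0 < M i" "M i < x0 + \<delta>" if "i \<le> n" for i
  proof -
    show "x0 < M i"
      using s by (simp add: M_def)
    have "s * (real i + 1 / 2) < s * (real n + 1)"
      using s that by (intro mult_strict_left_mono) auto
    then show "M i < x0 + \<delta>"
      by (simp add: M_def s_def)
  qed
  have poly_p: "poly (p t) x = (\<Prod>i\<in>{1..n}. x + a i) + t * x ^ k" for t x
    by (simp add: p_def poly_perturbed_poly del: One_nat_def)
  have sign_change: "poly (p 0) (- M i) * poly (p 0) (- M (i - 1)) < 0" if i: "i \<in> {1..n}" for i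
  proof -
    have "poly (p 0) (- M i) * poly (p 0) (- M (i - 1)) =
        (\<Prod>j\<in>{1..n}. (- M i + a j) * (- M (i - 1) + a j))"
      by (simp add: poly_p prod.distrib del: One_nat_def)
    also have "\<dots> = (- M i + a i) * (- M (i - 1) + a i) *
        (\<Prod>j\<in>{1..n} - {i}. (- M i + a j) * (- M (i - 1) + a j))"
      using i by (intro prod.remove) auto
    also have "\<dots> < 0"
    proof (rule mult_neg_pos)
      have "- M i + a i = - s / 2" "- M (i - 1) + a i = s / 2"
        using i by (auto simp: M_def a_def of_nat_diff algebra_simps)
      then show "(- M i + a i) * (- M (i - 1) + a i) < 0"
        using s by simp
      \<comment> \<open>Only node \<open>i\<close> lies between the two halfway points; every other
        node is on the same side of both.\<close>
      show "0 < (\<Prod>j\<in>{1..n} - {i}. (- M i + a j) * (- M (i - 1) + a j))"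
      proof (rule prod_pos)
        fix j assume j: "j \<in> {1..n} - {i}"
        have eq: "- M i + a j = s * (real j - real i - 1 / 2)"
          "- M (i - 1) + a j = s * (real j - real i + 1 / 2)"
          using i by (auto simp: M_def a_def of_nat_diff algebra_simps)
        show "0 < (- M i + a j) * (- M (i - 1) + a j)"
        proof (cases "j < i")
          case True
          then have "real j + 1 \<le> real i" by linarith
          then show ?thesis
            unfolding eq using s by (intro mult_neg_neg mult_pos_neg) auto
        next
          case False
          then have "real i + 1 \<le> real j" using j by auto
          then show ?thesis
            unfolding eq using s by (intro mult_pos_pos) auto
        qed
      qed
    qed
    finally show ?thesis .
  qed
  have "\<forall>\<^sub>F t in at_right 0. \<forall>i\<in>{1..n}. poly (p t) (- M i) * poly (p t) (- M (i - 1)) < 0"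
  proof (intro eventually_ball_finite ballI)
    fix i assume i: "i \<in> {1..n}"
    have "((\<lambda>t. poly (p t) x) \<longlongrightarrow> poly (p 0) x) (at_right 0)" for x
      unfolding poly_p by (intro tendsto_intros)
    then have "((\<lambda>t. poly (p t) (- M i) * poly (p t) (- M (i - 1))) \<longlongrightarrow>
        poly (p 0) (- M i) * poly (p 0) (- M (i - 1))) (at_right 0)"
      by (intro tendsto_mult)
    then show "\<forall>\<^sub>F t in at_right 0. poly (p t) (- M i) * poly (p t) (- M (i - 1)) < 0"
      using sign_change[OF i] by (rule order_tendstoD(2))
  qed simp
  then obtain e' where "e' > 0" and
    e': "\<And>t i. 0 < t \<Longrightarrow> t < e' \<Longrightarrow> i \<in> {1..n} \<Longrightarrow> poly (p t) (- M i) * poly (p t) (- M (i - 1)) < 0"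
    unfolding eventually_at_right_field by blast
  define e where "e = e' / 2"
  have e: "0 < e" "e < e'"
    using \<open>e' > 0\<close> by (auto simp: e_def)
  have main: "card {x. poly (p t) x = 0} = n \<and> (\<forall>x. poly (p t) x = 0 \<longrightarrow> - x \<in> {x0<..<x0 + \<delta>})"
    if t: "t \<in> {0<..e}" for t
  proof -
    have "\<exists>x. - M i < x \<and> x < - M (i - 1) \<and> poly (p t) x = 0" if i: "i \<in> {1..n}" for i
      using poly_IVT[of "- M i" "- M (i - 1)" "p t"] e'[of t i] M_mono[of "i - 1" i] t e i by auto
    then obtain r where r: "\<And>i. i \<in> {1..n} \<Longrightarrow> - M i < r i \<and> r i < - M (i - 1) \<and> poly (p t) (r i) = 0"
      by metis
    have less: "r j < r i" if "i \<in> {1..n}" "j \<in> {1..n}" "i < j" for i j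
    proof -
      have "i = j - 1 \<or> i < j - 1"
        using that(3) by linarith
      then have "M i \<le> M (j - 1)"
        using M_mono[of i "j - 1"] by (auto intro: less_imp_le)
      then show ?thesis
        using r[OF that(1)] r[OF that(2)] by linarith
    qed
    have "inj_on r {1..n}"
    proof (rule linorder_inj_onI)
      show "r i \<noteq> r j" if "i < j" "i \<in> {1..n}" "j \<in> {1..n}" for i j
        using less[OF that(2,3,1)] by simp
    qed auto
    then have card_r: "card (r ` {1..n}) = n"
      by (simp add: card_image)
    have "coeff (p t) n = 1"
      using k by (simp add: p_def coeff_perturbed_poly E_self)
    then have "p t \<noteq> 0"
      by auto
    then have "finite {x. poly (p t) x = 0}" "card {x. poly (p t) x = 0} \<le> n"
      using card_poly_roots_bound[of "p t"] degree_perturbed_poly_le[of "{k}" n a "\<lambda>_. t"] k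
      by (auto simp: p_def poly_roots_finite)
    \<comment> \<open>One root in each of \<open>n\<close> disjoint gaps already exhausts the degree
      bound, so no root lies elsewhere.\<close>
    then have roots: "r ` {1..n} = {x. poly (p t) x = 0}"
      using r card_r by (intro card_seteq) auto
    have "- r i \<in> {x0<..<x0 + \<delta>}" if i: "i \<in> {1..n}" for i
    proof -
      have "i \<le> n" "i - 1 \<le> n"
        using i by auto
      then show ?thesis
        using r[OF i] M_range(1)[of "i - 1"] M_range(2)[of i] by auto
    qed
    moreover have "x \<in> r ` {1..n}" if "poly (p t) x = 0" for x
      using that unfolding roots by simp
    ultimately have "- x \<in> {x0<..<x0 + \<delta>}" if "poly (p t) x = 0" for x
      using that by blast
    then show ?thesis
      using roots card_r by simp
  qed
  show ?thesis
    using that[of a e] a e main unfolding p_def by blast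
qed

text \<open>A wrong sign at \<open>x0\<close> persists on an interval to its right. Nodes placed
  there and the curve with \<open>B k t = t\<close> keep all roots, hence also
  \<open>\<xi> k\<close>, in that interval, so the sum of \<open>f\<close> strictly decreases while
  only \<open>E n k\<close> grows.\<close>

lemma derivative_sign_if_sum_le:
  assumes n: "n \<ge> 2" and k: "k \<in> {1..n - 1}" and f: "C_pos n f" and "0 < x0"
    and le: "\<And>a b. a \<in> Delta n \<Longrightarrow> b \<in> Delta n \<Longrightarrow> E n k a \<le> E n k b \<Longrightarrow>
      (\<And>l. l < n \<Longrightarrow> l \<noteq> k \<Longrightarrow> E n l a = E n l b) \<Longrightarrow>
      (\<Sum>i\<in>{1..n}. f (a i)) \<le> (\<Sum>i\<in>{1..n}. f (b i))"
  shows "(-1) ^ (n + k) * (deriv ^^ (n - 1)) (\<lambda>u. u ^ k * deriv f u) x0 \<le> 0"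
proof (rule ccontr)
  define G where "G = (deriv ^^ (n - 1)) (\<lambda>u. u ^ k * deriv f u)"
  assume "\<not> ?thesis"
  then have pos: "0 < (-1) ^ (n + k) * G x0"
    by (simp add: G_def)
  have "C_pos (n - 1) (deriv f)"
    using f n by (cases n) (auto intro: C_pos_SucD)
  then have "C_pos (n - 1) (\<lambda>u. u ^ k * deriv f u)"
    using C_pos_mult[OF C_pos_poly[of "n - 1" "monom 1 k"]] by (simp add: poly_monom)
  then have "continuous_on {0<..} G"
    by (simp add: C_pos_def G_def)
  then have "isCont G x0"
    using \<open>0 < x0\<close> by (simp add: continuous_on_eq_continuous_at)
  then have "((\<lambda>x. (-1) ^ (n + k) * G x) \<longlongrightarrow> (-1) ^ (n + k) * G x0) (at_right x0)"
    unfolding isCont_def by (intro tendsto_intros filterlim_at_split[THEN iffD1, THEN conjunct2])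
  then have "\<forall>\<^sub>F x in at_right x0. 0 < (-1) ^ (n + k) * G x"
    using pos by (rule order_tendstoD(1))
  then obtain b where "b > x0" and b: "\<And>x. x0 < x \<Longrightarrow> x < b \<Longrightarrow> 0 < (-1) ^ (n + k) * G x"
    unfolding eventually_at_right_field by blast
  have kn: "k < n" "{k} \<subseteq> {..<n}" and n1: "n \<ge> 1"
    using k n by auto
  obtain a e where a: "a \<in> Delta n" and "0 < e"
    and card: "\<And>t. t \<in> {0<..e} \<Longrightarrow> card {x. poly (perturbed_poly n {k} a (\<lambda>_. t)) x = 0} = n"
    and range: "\<And>t x. t \<in> {0<..e} \<Longrightarrow> poly (perturbed_poly n {k} a (\<lambda>_. t)) x = 0 \<Longrightarrow> - x \<in> {x0<..<b}"
    using ex_small_perturbation_roots[OF \<open>0 < x0\<close> _ kn(1), of "b - x0"] \<open>b > x0\<close> by auto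
  obtain c where c: "\<And>t. t \<in> {0..e} \<Longrightarrow> c t \<in> Delta n"
    "\<And>t. t \<in> {0<..e} \<Longrightarrow> inj_on (c t) {1..n}"
    "\<And>t i. t \<in> {0..e} \<Longrightarrow> i \<notin> {1..n} \<Longrightarrow> c t i = 0"
    "\<And>t. t \<in> {0..e} \<Longrightarrow> perturbed_poly n {k} a (\<lambda>_. t) = (\<Prod>i\<in>{1..n}. [:c t i, 1:])"
    "\<And>i. i \<in> {1..n} \<Longrightarrow> c 0 i = a i"
    "\<And>i. continuous_on {0..e} (\<lambda>t. c t i)"
  proof (rule ex_root_curve[of n a "{k}" e "\<lambda>_ t. t", OF n1 a kn(2)])
    show "mono_on {0..e} (\<lambda>t. t)"
      by (rule mono_onI)
    show "0 \<le> e"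
      using \<open>0 < e\<close> by simp
    show "continuous_on {0..e} (\<lambda>t. t)"
      by (rule continuous_on_id)
    show "card {x. poly (perturbed_poly n {k} a (\<lambda>_. t)) x = 0} = n" if "t \<in> {0<..e}" for t
      using that by (rule card)
  qed (rule refl, rule that)
  have "\<exists>\<tau>\<in>{0<..<e}. \<exists>\<xi>. (\<forall>k. \<xi> k \<in> {c \<tau> 1..c \<tau> n}) \<and>
    (\<Sum>i\<in>{1..n}. f (c e i)) - (\<Sum>i\<in>{1..n}. f (c 0 i)) =
    e * (\<Sum>k\<in>{k}. 1 * ((-1) ^ (k + (n - 1)) *
      (deriv ^^ (n - 1)) (\<lambda>u. u ^ k * deriv f u) (\<xi> k) / fact (n - 1)))"
  proof (rule root_curve_sum_mean_value[where D = "\<lambda>_ _. 1", OF n1 f \<open>0 < e\<close> c(1) _ _ c(6)])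
    show "inj_on (c t) {1..n}" if "t \<in> {0<..<e}" for t
      using that by (intro c(2)) simp
    show "perturbed_poly n {k} a (\<lambda>_. t) = (\<Prod>i\<in>{1..n}. [:c t i, 1:])" if "t \<in> {0<..<e}" for t
      using that by (intro c(4)) simp
    show "((\<lambda>t. t) has_real_derivative 1) (at t)" for t :: real
      by (rule DERIV_ident)
  qed
  then obtain \<tau> \<xi> where \<tau>: "\<tau> \<in> {0<..<e}" "\<And>l. \<xi> l \<in> {c \<tau> 1..c \<tau> n}"
    "(\<Sum>i\<in>{1..n}. f (c e i)) - (\<Sum>i\<in>{1..n}. f (c 0 i)) =
     e * (\<Sum>k\<in>{k}. 1 * ((-1) ^ (k + (n - 1)) *
      (deriv ^^ (n - 1)) (\<lambda>u. u ^ k * deriv f u) (\<xi> k) / fact (n - 1)))"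
    by blast
  have "c \<tau> i \<in> {x0<..<b}" if i: "i \<in> {1..n}" for i
  proof -
    have "poly (\<Prod>j\<in>{1..n}. [:c \<tau> j, 1:]) (- c \<tau> i) = 0"
      unfolding poly_prod_linear using i by (intro prod_zero) auto
    then show ?thesis
      using range[of \<tau> "- c \<tau> i"] c(4)[of \<tau>] \<tau>(1) by simp
  qed
  from this[of 1] this[of n] have "x0 < \<xi> k" "\<xi> k < b"
    using \<tau>(2)[of k] n1 by auto
  then have "0 < (-1) ^ (n + k) * G (\<xi> k)"
    by (rule b)
  moreover have "(-1::real) ^ (n + k) = - ((-1) ^ (k + (n - 1)))"
    using n1 by (cases n) (simp_all add: add.commute)
  ultimately have "(-1) ^ (k + (n - 1)) * G (\<xi> k) / fact (n - 1) < 0"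
    by (intro divide_neg_pos) auto
  with \<open>0 < e\<close> have "e * ((-1) ^ (k + (n - 1)) * G (\<xi> k) / fact (n - 1)) < 0"
    by (rule mult_pos_neg)
  then have "(\<Sum>i\<in>{1..n}. f (c e i)) < (\<Sum>i\<in>{1..n}. f (c 0 i))"
    using \<tau>(3) by (simp add: G_def)
  moreover have "(\<Sum>i\<in>{1..n}. f (c 0 i)) = (\<Sum>i\<in>{1..n}. f (a i))"
    using c(5) by simp
  moreover have E_c: "E n l (c e) = E n l a + (if l = k then e else 0)" if "l < n" for l
    using coeff_perturbed_poly[of "{k}" l n a "\<lambda>_. e"] coeff_prod_linear[of l n "c e"] c(4)[of e]
      \<open>0 < e\<close> that by simp
  moreover have "(\<Sum>i\<in>{1..n}. f (a i)) \<le> (\<Sum>i\<in>{1..n}. f (c e i))"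
    using E_c kn(1) \<open>0 < e\<close> by (intro le a c(1)) auto
  ultimately show False
    by simp
qed

theorem corollary3p9:
  fixes n :: nat and T :: "nat set" and f :: "real \<Rightarrow> real"
  assumes "n \<ge> 2"
    and "T \<subseteq> {1..n - 1}"
    and "\<And>S. S \<subseteq> T \<Longrightarrow> S \<noteq> {} \<Longrightarrow> property_P n S"
    and "C_pos n f"
  shows "(\<forall>a \<in> Delta n. \<forall>b \<in> Delta n.
            (\<forall>k\<in>T. E n k a \<le> E n k b) \<and>
            (\<forall>k\<in>{0..n - 1}. k = 0 \<or> k \<notin> T \<longrightarrow> E n k a = E n k b) \<longrightarrow>
            (\<Sum>i=1..n. f (a i)) \<le> (\<Sum>i=1..n. f (b i)))
         \<longleftrightarrow>
         (\<forall>x>0. \<forall>k\<in>T. (-1) ^ (n + k) * (deriv ^^ (n - 1)) (\<lambda>u. u ^ k * deriv f u) x \<le> 0)"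
    (is "?sum_le \<longleftrightarrow> ?sign")
proof
  assume ?sign
  show ?sum_le
  proof (intro ballI impI)
    fix a b
    assume "a \<in> Delta n" "b \<in> Delta n" and
      "(\<forall>k\<in>T. E n k a \<le> E n k b) \<and> (\<forall>k\<in>{0..n - 1}. k = 0 \<or> k \<notin> T \<longrightarrow> E n k a = E n k b)"
    then show "(\<Sum>i=1..n. f (a i)) \<le> (\<Sum>i=1..n. f (b i))"
      using \<open>?sign\<close> by (intro sum_le_sum_if_E_le[OF assms]) auto
  qed
next
  assume sum_le: ?sum_le
  show ?sign
  proof (intro allI impI ballI)
    fix x :: real and k
    assume "x > 0" "k \<in> T"
    show "(-1) ^ (n + k) * (deriv ^^ (n - 1)) (\<lambda>u. u ^ k * deriv f u) x \<le> 0"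
    proof (rule derivative_sign_if_sum_le[OF \<open>n \<ge> 2\<close> _ \<open>C_pos n f\<close> \<open>x > 0\<close>])
      show k: "k \<in> {1..n - 1}"
        using assms(2) \<open>k \<in> T\<close> by blast
      fix a b
      assume ab: "a \<in> Delta n" "b \<in> Delta n" "E n k a \<le> E n k b"
        "\<And>l. l < n \<Longrightarrow> l \<noteq> k \<Longrightarrow> E n l a = E n l b"
      \<comment> \<open>Pairs differing only in \<open>E n k\<close> satisfy the constraints for all
        of \<open>T\<close>, so a single index can be tested at a time.\<close>
      have "E n l a \<le> E n l b" if "l \<in> T" for l
      proof -
        have "l < n"
          using that assms(1,2) by fastforce
        then show ?thesis
          using ab(3) ab(4)[of l] by (cases "l = k") auto
      qed
      moreover have "E n l a = E n l b" if "l \<in> {0..n - 1}" "l = 0 \<or> l \<notin> T" for l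
      proof (rule ab(4))
        show "l < n"
          using that(1) assms(1) by auto
        \<comment> \<open>Here \<open>k \<ge> 1\<close> settles \<open>l = 0\<close>, and
          \<open>k \<in> T\<close> settles the other case.\<close>
        show "l \<noteq> k"
          using that(2) \<open>k \<in> T\<close> k by auto
      qed
      ultimately show "(\<Sum>i=1..n. f (a i)) \<le> (\<Sum>i=1..n. f (b i))"
        using sum_le ab(1,2) by blast
    qed
  qed
qed

end
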